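(* Let $\ell(i)$, $i\in\mathbb{N}$, be a (deterministic) decreasing sequence of positive real numbers, and let $A_\ell$ be the random real tree given by the stick breaking process with segment lengths $\ell$. Then $d(A_\ell)<\infty$ almost surely if and only if $$\sum_{n\ge1}\frac{\ell(n)}{n}<\infty,$$ or equivalently, if and only if $$\sum_{n\ge1}\ell(2^n)<\infty.$$
   Context: $\mathbb{N}=\{1,2,\dots\}$. Given the sequence $\ell$, random rooted real trees $A_\ell(i)$ are defined recursively: $A_\ell(1)$ is a closed segment of length $\ell(1)$ rooted at one of its ends; for $i\ge1$, $A_\ell(i+1)$ is obtained from $A_\ell(i)$ by attaching one end of a closed segment of length $\ell(i+1)$ to a uniformly random point of $A_\ell(i)$ (uniform with respect to normalized length measure, independently of the past given $A_\ell(i)$). Put $A_\ell^o=\bigcup_{i\ge1}A_\ell(i)$, with the tree metric, and let $A_\ell$ be the completion of $A_\ell^o$. The height $d(A)$ of a rooted real tree $A$ is the supremum of the distances from points of $A$ to the root. *)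

theory Defs
  imports "HOL-Probability.Probability"
begin

section \<open>Rooted metric spaces: completion and height\<close>

definition is_completion :: "'a metric \<Rightarrow> ('a \<Rightarrow> 'b) \<Rightarrow> 'b metric \<Rightarrow> bool" where
  "is_completion m f m' \<longleftrightarrow>
     mcomplete_of m' \<and> f \<in> mspace m \<rightarrow> mspace m' \<and>
     (\<forall>x\<in>mspace m. \<forall>y\<in>mspace m. mdist m' (f x) (f y) = mdist m x y) \<and>
     mtopology_of m' closure_of (f ` mspace m) = mspace m'"

(* A rooted metric space is a pair (m, r) with root r.  The completion of m is unique up to an
   isometry that fixes m, so the choice below is immaterial; a completion whose points are
   functions 'a => real always exists (metric_completion). *)
definition rooted_completion ::
  "'a metric \<times> 'a \<Rightarrow> ('a \<Rightarrow> real) metric \<times> ('a \<Rightarrow> real)" where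
  "rooted_completion T = (SOME (m', r'). \<exists>f. is_completion (fst T) f m' \<and> r' = f (snd T))"

lemma rooted_completion_spec:
  obtains f where "is_completion m f (fst (rooted_completion (m, r)))"
    and "snd (rooted_completion (m, r)) = f r"
proof -
  interpret Metric_space "mspace m" "mdist m" by simp
  obtain f :: "['a,'a] \<Rightarrow> real" and m' where "is_completion m f m'"
    unfolding is_completion_def by (metis metric_completion)
  then have "\<exists>T'. case T' of (m', r') \<Rightarrow> \<exists>f::'a \<Rightarrow> 'a \<Rightarrow> real. is_completion m f m' \<and> r' = f r"
    by blast
  then have "case rooted_completion (m, r) of
      (m', r') \<Rightarrow> \<exists>f::'a \<Rightarrow> 'a \<Rightarrow> real. is_completion m f m' \<and> r' = f r"
    unfolding rooted_completion_def fst_conv snd_conv by (rule someI_ex)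
  then show thesis using that by (auto split: prod.splits)
qed

definition rooted_height :: "'a metric \<times> 'a \<Rightarrow> ennreal" where
  "rooted_height T = (SUP x\<in>mspace (fst T). ennreal (mdist (fst T) (snd T) x))"


section \<open>Stick breaking trees\<close>

(* Points of the trees are pairs (k, s): the point at distance s from the attached end of the
   k-th segment.  For k > 1 the attached end (k, 0) is omitted, since it is identified with the
   attachment point in the earlier tree; (1, 0) is the root. *)
definition stick_root :: "nat \<times> real" where
  "stick_root = (1, 0)"

definition stick_points :: "(nat \<Rightarrow> real) \<Rightarrow> nat \<Rightarrow> (nat \<times> real) set" where
  "stick_points l n = insert stick_root (\<Union>k\<in>{1..n}. {k} \<times> {0<..l k})"

(* Glue the end (k, 0) of a new segment {k} x [0, L] to the point v of m.  The absolute values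
   only matter off the carrier, where the type of metrics still requires nonnegativity. *)
definition attach_segment ::
  "nat \<Rightarrow> real \<Rightarrow> nat \<times> real \<Rightarrow> (nat \<times> real) metric \<Rightarrow> (nat \<times> real) metric" where
  "attach_segment k L v m = metric (mspace m \<union> {k} \<times> {0<..L}, \<lambda>p q.
     if p \<in> mspace m then
       (if q \<in> mspace m then mdist m p q else mdist m p v + \<bar>snd q\<bar>)
     else
       (if q \<in> mspace m then \<bar>snd p\<bar> + mdist m v q else \<bar>snd p - snd q\<bar>))"

lemma Metric_space_attach_segment:
  fixes m :: "(nat \<times> real) metric"
  assumes "v \<in> mspace m" and "mspace m \<inter> {k} \<times> {0<..L} = {}"
  shows "Metric_space (mspace m \<union> {k} \<times> {0<..L}) (\<lambda>p q.
     if p \<in> mspace m then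
       (if q \<in> mspace m then mdist m p q else mdist m p v + \<bar>snd q\<bar>)
     else
       (if q \<in> mspace m then \<bar>snd p\<bar> + mdist m v q else \<bar>snd p - snd q\<bar>))"
    (is "Metric_space ?M ?d")
proof
  fix x y :: "nat \<times> real"
  show "0 \<le> ?d x y" by auto
  show "?d x y = ?d y x"
    by (auto simp: mdist_commute add.commute)
next
  fix x y :: "nat \<times> real" assume "x \<in> ?M" "y \<in> ?M"
  then show "?d x y = 0 \<longleftrightarrow> x = y"
    using assms by (auto simp: add_nonneg_eq_0_iff)
next
  fix x y z :: "nat \<times> real" assume "x \<in> ?M" "y \<in> ?M" "z \<in> ?M"
  then show "?d x z \<le> ?d x y + ?d y z"
    using assms mdist_triangle[of x m y z] mdist_triangle[of x m y v]
      mdist_triangle[of x m v z] mdist_triangle[of v m y z] mdist_nonneg[of m v y]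
    by (auto simp: mdist_commute simp del: mdist_nonneg)
qed

lemma attach_segment_simps:
  assumes "v \<in> mspace m" and "mspace m \<inter> {k} \<times> {0<..L} = {}"
  shows "mspace (attach_segment k L v m) = mspace m \<union> {k} \<times> {0<..L}"
    and "mdist (attach_segment k L v m) p q =
      (if p \<in> mspace m then
         (if q \<in> mspace m then mdist m p q else mdist m p v + \<bar>snd q\<bar>)
       else
         (if q \<in> mspace m then \<bar>snd p\<bar> + mdist m v q else \<bar>snd p - snd q\<bar>))"
  unfolding attach_segment_def
  by (simp_all add: Metric_space.mspace_metric[OF Metric_space_attach_segment[OF assms]]
      Metric_space.mdist_metric[OF Metric_space_attach_segment[OF assms]])

(* stick_tree l v n is the n-th tree; v i is the point of the i-th tree at which the (i+1)-st
   segment is attached.  Trees are numbered from 1; the value at 0 is a dummy. *)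
fun stick_tree ::
  "(nat \<Rightarrow> real) \<Rightarrow> (nat \<Rightarrow> nat \<times> real) \<Rightarrow> nat \<Rightarrow> (nat \<times> real) metric" where
  "stick_tree l v 0 = metric ({}, \<lambda>p q. 0)"
| "stick_tree l v (Suc 0) = metric ({1} \<times> {0..l 1}, \<lambda>p q. \<bar>snd p - snd q\<bar>)"
| "stick_tree l v (Suc (Suc i)) =
     attach_segment (Suc (Suc i)) (l (Suc (Suc i))) (v (Suc i)) (stick_tree l v (Suc i))"

definition stick_union ::
  "(nat \<Rightarrow> real) \<Rightarrow> (nat \<Rightarrow> nat \<times> real) \<Rightarrow> (nat \<times> real) metric" where
  "stick_union l v = metric (\<Union>n\<in>{1..}. mspace (stick_tree l v n),
     \<lambda>p q. mdist (stick_tree l v (max (fst p) (fst q))) p q)"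

definition stick_limit ::
  "(nat \<Rightarrow> real) \<Rightarrow> (nat \<Rightarrow> nat \<times> real) \<Rightarrow>
     (nat \<times> real \<Rightarrow> real) metric \<times> (nat \<times> real \<Rightarrow> real)" where
  "stick_limit l v = rooted_completion (stick_union l v, stick_root)"

lemma Metric_space_segment: "Metric_space ({k} \<times> A) (\<lambda>p q. \<bar>snd p - snd q\<bar>)"
  for k :: nat and A :: "real set"
  by unfold_locales auto

context
  fixes l :: "nat \<Rightarrow> real" and v :: "nat \<Rightarrow> nat \<times> real"
  assumes l_pos: "\<And>i. i \<ge> 1 \<Longrightarrow> 0 < l i"
    and v_in: "\<And>i. i \<ge> 1 \<Longrightarrow> v i \<in> stick_points l i"
begin

lemma stick_points_Suc: "stick_points l (Suc n) = stick_points l n \<union> {Suc n} \<times> {0<..l (Suc n)}"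
  by (auto simp: stick_points_def atLeastAtMostSuc_conv)

lemma stick_points_fst: "p \<in> stick_points l n \<Longrightarrow> n \<ge> 1 \<Longrightarrow> 1 \<le> fst p \<and> fst p \<le> n"
  by (auto simp: stick_points_def stick_root_def)

lemma stick_points_disjoint:
  "stick_points l (Suc n) \<inter> {Suc (Suc n)} \<times> {0<..l (Suc (Suc n))} = {}"
  by (auto simp: stick_points_def stick_root_def)

lemma mspace_stick_tree: "mspace (stick_tree l v (Suc n)) = stick_points l (Suc n)"
proof (induction n)
  case 0
  show ?case
    using l_pos[of 1]
    by (auto simp: Metric_space.mspace_metric[OF Metric_space_segment] stick_points_def
        stick_root_def)
next
  case (Suc n)
  show ?case
    using attach_segment_simps(1)[of "v (Suc n)" "stick_tree l v (Suc n)"] v_in[of "Suc n"]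
      stick_points_disjoint[of n] stick_points_Suc[of "Suc n"]
    by (simp add: Suc.IH)
qed

lemma mdist_stick_tree_Suc_Suc:
  "mdist (stick_tree l v (Suc (Suc n))) p q =
     (if p \<in> stick_points l (Suc n) then
        (if q \<in> stick_points l (Suc n) then mdist (stick_tree l v (Suc n)) p q
         else mdist (stick_tree l v (Suc n)) p (v (Suc n)) + \<bar>snd q\<bar>)
      else
        (if q \<in> stick_points l (Suc n) then \<bar>snd p\<bar> + mdist (stick_tree l v (Suc n)) (v (Suc n)) q
         else \<bar>snd p - snd q\<bar>))"
  using attach_segment_simps(2)[of "v (Suc n)" "stick_tree l v (Suc n)"] v_in[of "Suc n"]
      stick_points_disjoint[of n] by (simp add: mspace_stick_tree)

lemma mdist_stick_tree_mono:
  assumes "p \<in> stick_points l (Suc n)" "q \<in> stick_points l (Suc n)" "n \<le> n'"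
  shows "mdist (stick_tree l v (Suc n')) p q = mdist (stick_tree l v (Suc n)) p q"
  using assms(3)
proof (induction n' rule: dec_induct)
  case (step k)
  have "stick_points l (Suc n) \<subseteq> stick_points l (Suc k)"
    using step(1) by (fastforce simp: stick_points_def)
  then show ?case
    using assms(1,2) step.IH by (auto simp: mdist_stick_tree_Suc_Suc simp del: stick_tree.simps)
qed simp

lemma stick_points_lift:
  assumes "p \<in> stick_points l m" "fst p \<le> n" "1 \<le> m" "1 \<le> n"
  shows "p \<in> stick_points l n"
  using assms by (auto simp: stick_points_def)

lemma mdist_stick_tree_max:
  assumes "p \<in> stick_points l n" "q \<in> stick_points l n" "n \<ge> 1"
  shows "mdist (stick_tree l v (max (fst p) (fst q))) p q = mdist (stick_tree l v n) p q"
proof -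
  define k where "k = max (fst p) (fst q)"
  have k: "1 \<le> k" "k \<le> n"
    using stick_points_fst[OF assms(1,3)] stick_points_fst[OF assms(2,3)] by (auto simp: k_def)
  have "p \<in> stick_points l k" "q \<in> stick_points l k"
    using assms k by (auto intro: stick_points_lift simp: k_def)
  with k show ?thesis
    using mdist_stick_tree_mono[of p "k - 1" q "n - 1"] assms(3) by (simp add: k_def[symmetric])
qed

lemma Metric_space_stick_union:
  "Metric_space (\<Union>n\<in>{1..}. mspace (stick_tree l v n))
     (\<lambda>p q. mdist (stick_tree l v (max (fst p) (fst q))) p q)"
proof -
  have sp: "mspace (stick_tree l v n) = stick_points l n" if "n \<ge> 1" for n
    using mspace_stick_tree[of "n - 1"] that by simp
  have mono: "stick_points l n \<subseteq> stick_points l n'" if "n \<le> n'" for n n'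
    using that by (fastforce simp: stick_points_def)
  show ?thesis
  proof
    fix x y
    show "0 \<le> mdist (stick_tree l v (max (fst x) (fst y))) x y" by simp
    show "mdist (stick_tree l v (max (fst x) (fst y))) x y =
        mdist (stick_tree l v (max (fst y) (fst x))) y x"
      by (simp add: mdist_commute max.commute)
  next
    fix x y
    assume "x \<in> (\<Union>n\<in>{1..}. mspace (stick_tree l v n))" "y \<in> (\<Union>n\<in>{1..}. mspace (stick_tree l v n))"
    then obtain i j where ij: "i \<ge> 1" "j \<ge> 1" "x \<in> stick_points l i" "y \<in> stick_points l j"
      using sp by auto
    define n where "n = max i j"
    have n: "n \<ge> 1" "x \<in> stick_points l n" "y \<in> stick_points l n"
      using ij mono[of i n] mono[of j n] by (auto simp: n_def)
    then show "mdist (stick_tree l v (max (fst x) (fst y))) x y = 0 \<longleftrightarrow> x = y"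
      using mdist_stick_tree_max[OF n(2,3,1)] sp[OF n(1)] by simp
  next
    fix x y z
    assume "x \<in> (\<Union>n\<in>{1..}. mspace (stick_tree l v n))" "y \<in> (\<Union>n\<in>{1..}. mspace (stick_tree l v n))"
      "z \<in> (\<Union>n\<in>{1..}. mspace (stick_tree l v n))"
    then obtain i j k where ijk: "i \<ge> 1" "j \<ge> 1" "k \<ge> 1"
        "x \<in> stick_points l i" "y \<in> stick_points l j" "z \<in> stick_points l k"
      using sp by auto
    define n where "n = max i (max j k)"
    have le: "i \<le> n" "j \<le> n" "k \<le> n" by (auto simp: n_def)
    have n: "n \<ge> 1" "x \<in> stick_points l n" "y \<in> stick_points l n" "z \<in> stick_points l n"
      using ijk le mono[OF le(1)] mono[OF le(2)] mono[OF le(3)] by auto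
    then show "mdist (stick_tree l v (max (fst x) (fst z))) x z \<le>
        mdist (stick_tree l v (max (fst x) (fst y))) x y + mdist (stick_tree l v (max (fst y) (fst z))) y z"
      using mdist_stick_tree_max[OF n(2,3,1)] mdist_stick_tree_max[OF n(2,4,1)]
        mdist_stick_tree_max[OF n(3,4,1)] sp[OF n(1)] mdist_triangle by metis
  qed
qed

lemma mspace_stick_union: "mspace (stick_union l v) = (\<Union>n\<in>{1..}. mspace (stick_tree l v n))"
  unfolding stick_union_def by (rule Metric_space.mspace_metric[OF Metric_space_stick_union])

lemma mdist_stick_union:
  "mdist (stick_union l v) p q = mdist (stick_tree l v (max (fst p) (fst q))) p q"
  unfolding stick_union_def Metric_space.mdist_metric[OF Metric_space_stick_union] ..

end


section \<open>The random stick breaking tree\<close>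

definition stick_length_measure :: "(nat \<times> real) measure" where
  "stick_length_measure = count_space UNIV \<Otimes>\<^sub>M lborel"

lemma emeasure_stick_points:
  assumes "\<And>i. i \<ge> 1 \<Longrightarrow> 0 < l i"
  shows "emeasure stick_length_measure (stick_points l n) = ennreal (\<Sum>i=1..n. l i)"
proof -
  interpret S: sigma_finite_measure "count_space (UNIV :: nat set)"
    by (rule sigma_finite_measure_count_space)
  interpret P: pair_sigma_finite "count_space (UNIV :: nat set)" "lborel :: real measure" ..
  have rect: "emeasure stick_length_measure ({k} \<times> A) = emeasure lborel A" if "A \<in> sets borel"
    for k :: nat and A :: "real set"
    unfolding stick_length_measure_def
    using that by (subst lborel.emeasure_pair_measure_Times) auto
  have sets: "{k} \<times> A \<in> sets stick_length_measure" if "A \<in> sets borel"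
    for k :: nat and A :: "real set"
    unfolding stick_length_measure_def using that by auto
  have rt: "{stick_root} = {1} \<times> {0}" by (auto simp: stick_root_def)
  have "stick_points l n = {stick_root} \<union> (\<Union>k\<in>{1..n}. {k} \<times> {0<..l k})"
    by (auto simp: stick_points_def)
  moreover have rn: "{stick_root} \<in> null_sets stick_length_measure"
    using sets[of "{0}" 1] rect[of "{0}" 1] unfolding rt by (auto simp: null_sets_def)
  ultimately have "emeasure stick_length_measure (stick_points l n) =
      emeasure stick_length_measure (\<Union>k\<in>{1..n}. {k} \<times> {0<..l k})"
    using emeasure_Un_null_set[OF _ rn, of "\<Union>k\<in>{1..n}. {k} \<times> {0<..l k}"] sets
    by (simp add: Un_commute sets.finite_UN)
  also have "\<dots> = (\<Sum>k=1..n. emeasure stick_length_measure ({k} \<times> {0<..l k}))"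
    using sets by (intro sum_emeasure[symmetric]) (auto simp: disjoint_family_on_def)
  also have "\<dots> = (\<Sum>k=1..n. ennreal (l k))"
    using assms by (intro sum.cong) (auto simp: rect less_imp_le)
  also have "\<dots> = ennreal (\<Sum>k=1..n. l k)"
    using assms by (intro sum_ennreal) (auto simp: less_imp_le)
  finally show ?thesis .
qed

(* X i is the uniform random point of the i-th tree at which the (i+1)-st segment is attached.
   In these coordinates the law of X i is the same whatever the past is, so choosing
   X i independently of the past amounts to independence of the family X 1, X 2, ... *)
locale stick_breaking = prob_space M for M :: "'w measure" +
  fixes l :: "nat \<Rightarrow> real" and X :: "nat \<Rightarrow> 'w \<Rightarrow> nat \<times> real"
  assumes indep: "indep_vars (\<lambda>_. stick_length_measure) X {1..}"
    and uniform: "\<And>i. i \<ge> 1 \<Longrightarrow> distr M stick_length_measure (X i) =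
      uniform_measure stick_length_measure (stick_points l i)"

end

theory Submission
  imports Defs
begin

text \<open>
  Say that stick \<open>k + 1\<close> is a child of the stick that carries its attachment point.  As the lengths
  decrease, earlier sticks are the likelier parents, which makes this genealogy no deeper than that
  of a random recursive tree: the generation of stick \<open>n\<close> is a.s. \<open>O(log n)\<close>, so no path to the
  root is long if \<open>\<Sum>n. l (2 ^ n)\<close> converges.  Conversely, if time is cut into blocks long enough for
  every earlier stick to expect two children on its outer half in the next block, then these
  children survive like a supercritical branching process, and some path gains height in every
  block.

  \<^bold>\<open>Summability implies finite height.\<close>  The expectation of \<open>2 ^ generation n\<close> is at most \<open>n\<close>
  (\<open>nn_integral_gen_le\<close>): one conditions on the parent and uses that, by Chebyshev's sum inequality,
  the mean index of the parent of stick \<open>i + 1\<close> is at most \<open>(i + 1) / 2\<close>.  Hence a.s.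
  \<open>2 ^ generation n \<le> C * n ^ 3\<close> for all \<open>n\<close> (\<open>AE_gen_le\<close>), so that a stick of generation \<open>i\<close> has an
  index of order at least \<open>2 ^ (i / 3)\<close>.  The sticks on the path from any point to the root have
  pairwise different generations, so the path is no longer than
  \<open>\<Sum>i. l (2 ^ (i div 3 - c))\<close>, which is finite with \<open>\<Sum>n. l (2 ^ n)\<close> (\<open>AE_height_finite\<close>).

  \<^bold>\<open>Finite height implies summability.\<close>  Write \<open>L i\<close> for the total length of the first \<open>i\<close> sticks.
  Times \<open>a 0 = 1\<close>, \<open>a 1\<close>, \<open>a 2\<close>, ... are chosen such that \<open>a (r + 1)\<close> is the first \<open>b\<close> with
  \<open>l (a r) * (\<Sum>i=a r..<b. 1 / L i) \<ge> 4\<close>.  A stick with index at most \<open>a r\<close> has length at least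
  \<open>l (a r)\<close>, so the next block brings on average at least two children to its outer half.  Call
  every stick of the first block a climber, and in each later block those sticks that sit on the
  outer half of a climber of the previous block; let \<open>Z r\<close> be the number of climbers in block \<open>r\<close>.
  Given the past, the attachments within a block are independent, and \<open>(1 / 2) ^ Z r\<close> is a
  supermartingale (\<open>nn_integral_half_power_climbers_Suc\<close>).  So with probability at least \<open>1 / 2\<close> all
  \<open>Z r\<close> are positive, and then the height is at least \<open>(\<Sum>r<R. l (a (r + 1))) / 2\<close> for every \<open>R\<close>.
  If the height is a.s. finite, \<open>\<Sum>r. l (a r)\<close> therefore converges.

  It remains to see that this forces \<open>\<Sum>n. l n / n\<close> to converge.  With the running average
  \<open>m n = L n / n\<close>, the minimality of \<open>a (r + 1)\<close> bounds the part of \<open>\<Sum>n. l n / n\<close> in one block by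
  \<open>5 * m (a r)\<close>, and \<open>a (r + 1) \<ge> 5 * a r\<close> gives the contraction
  \<open>m (a (r + 1)) \<le> m (a r) / 5 + l (a r)\<close>, so \<open>\<Sum>r. m (a r)\<close> is controlled by \<open>\<Sum>r. l (a r)\<close>
  (\<open>summable_if_summable_block_time\<close>).

  The two series in the theorem converge together by Cauchy condensation.
\<close>

section \<open>The height of a completion\<close>

text \<open>The distance to the root is continuous, so its supremum can be computed on a dense subset.\<close>

lemma rooted_height_completion:
  assumes r: "r \<in> mspace m"
  shows "rooted_height (rooted_completion (m, r)) = rooted_height (m, r)"
proof -
  define m' where "m' = fst (rooted_completion (m, r))"
  obtain f where f: "is_completion m f m'" and r': "snd (rooted_completion (m, r)) = f r"
    unfolding m'_def by (rule rooted_completion_spec)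
  have maps: "f x \<in> mspace m'" if "x \<in> mspace m" for x
    using f that by (auto simp: is_completion_def)
  have iso: "mdist m' (f x) (f y) = mdist m x y" if "x \<in> mspace m" "y \<in> mspace m" for x y
    using f that by (auto simp: is_completion_def)
  have dense: "mtopology_of m' closure_of (f ` mspace m) = mspace m'"
    using f by (auto simp: is_completion_def)
  interpret m': Metric_space "mspace m'" "mdist m'" by simp
  have top: "mtopology_of m' = m'.mtopology"
    by (simp add: mtopology_of_def)
  let ?h = "rooted_height (m, r)"
  have le: "ennreal (mdist m' (f r) y) \<le> ?h" if y: "y \<in> mspace m'" for y
  proof (rule ennreal_le_epsilon)
    fix e :: real assume "0 < e"
    from y dense have "y \<in> m'.mtopology closure_of (f ` mspace m)"
      by (simp add: top)
    with \<open>0 < e\<close> obtain x where x: "x \<in> mspace m" "f x \<in> m'.mball y e"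
      unfolding m'.metric_closure_of by blast
    then have "mdist m' (f r) y \<le> mdist m r x + e"
      using m'.triangle[of "f r" "f x" y] maps[OF r] maps[OF x(1)] y iso[OF r x(1)]
        m'.commute[of y "f x"] by (auto simp: m'.in_mball)
    then have "ennreal (mdist m' (f r) y) \<le> ennreal (mdist m r x) + ennreal e"
      using \<open>0 < e\<close> by (simp flip: ennreal_plus)
    also have "\<dots> \<le> ?h + ennreal e"
      unfolding rooted_height_def using x(1) by (intro add_right_mono) (auto intro: SUP_upper)
    finally show "ennreal (mdist m' (f r) y) \<le> ?h + ennreal e" .
  qed
  have ge: "ennreal (mdist m r x) \<le> (SUP y\<in>mspace m'. ennreal (mdist m' (f r) y))"
    if "x \<in> mspace m" for x
    using that by (intro SUP_upper2[of "f x"]) (auto simp: iso r maps)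
  have "(SUP y\<in>mspace m'. ennreal (mdist m' (f r) y)) = ?h"
    using ge le by (intro antisym SUP_least) (auto simp: rooted_height_def intro!: SUP_least)
  then show ?thesis
    by (simp add: rooted_height_def m'_def r')
qed

section \<open>Genealogy of the sticks\<close>

text \<open>
  Both halves of the proof look at an attachment point only through the stick that carries it and
  the half of that stick on which it lies.  Keeping just these two data makes histories discrete,
  so that every function of finitely many of them is measurable.
\<close>

definition stick_code :: "(nat \<Rightarrow> real) \<Rightarrow> nat \<times> real \<Rightarrow> nat \<times> bool" where
  "stick_code l p = (fst p, l (fst p) / 2 < snd p)"

text \<open>
  \<open>J i\<close> is the stick that carries stick \<open>i + 1\<close>.  The guard is met by all attachment sequences of a
  stick breaking tree; for other \<open>J\<close> it secures termination.
\<close>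

function generation :: "(nat \<Rightarrow> nat) \<Rightarrow> nat \<Rightarrow> nat" where
  "generation J k = (if 1 < k \<and> J (k - 1) < k then Suc (generation J (J (k - 1))) else 0)"
  by auto
termination by (relation "Wellfounded.measure snd") auto

declare generation.simps [simp del]

text \<open>
  The sticks of block \<open>{a r<..a (Suc r)}\<close> that end a chain of sticks with one member in each of the
  blocks up to \<open>r\<close>, every member sitting on the outer half of its predecessor.  Attachment \<open>i\<close>
  concerns stick \<open>Suc i\<close>, hence the shift.
\<close>

primrec climbers :: "(nat \<Rightarrow> nat) \<Rightarrow> (nat \<Rightarrow> nat \<times> bool) \<Rightarrow> nat \<Rightarrow> nat set" where
  "climbers a y 0 = {a 0<..a 1}"
| "climbers a y (Suc r) =
     Suc ` {i \<in> {a (Suc r)..<a (Suc (Suc r))}. fst (y i) \<in> climbers a y r \<and> snd (y i)}"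

lemma climbers_subset: "climbers a y r \<subseteq> {a r<..a (Suc r)}"
  by (cases r) auto

lemma climbers_cong:
  assumes "mono a" "\<And>i. i \<in> {a 1..<a (Suc r)} \<Longrightarrow> y i = z i"
  shows "climbers a y r = climbers a z r"
  using assms(2)
proof (induction r)
  case (Suc r)
  have "y i = z i" if "i \<in> {a 1..<a (Suc r)}" for i
    using that Suc.prems[of i] monoD[OF assms(1), of "Suc r" "Suc (Suc r)"] by simp
  then have "climbers a y r = climbers a z r" by (rule Suc.IH)
  moreover have "y i = z i" if "i \<in> {a (Suc r)..<a (Suc (Suc r))}" for i
    using that Suc.prems[of i] monoD[OF assms(1), of 1 "Suc r"] by simp
  ultimately show ?case by auto
qed simp

lemma climbers_empty_Suc: "climbers a y r = {} \<Longrightarrow> climbers a y (Suc r) = {}"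
  by simp

lemma generation_cong:
  "(\<And>i. 1 \<le> i \<Longrightarrow> i < n \<Longrightarrow> J i = K i) \<Longrightarrow> generation J n = generation K n"
proof (induction n rule: less_induct)
  case (less n)
  show ?case
  proof (cases "1 < n \<and> J (n - 1) < n")
    case True
    then have "generation J (J (n - 1)) = generation K (J (n - 1))"
      by (intro less.IH less.prems) auto
    moreover have "J (n - 1) = K (n - 1)"
      using True by (intro less.prems) auto
    ultimately show ?thesis
      by (simp add: generation.simps[of _ n])
  next
    case False
    then show ?thesis
      using less.prems[of "n - 1"] by (auto simp: generation.simps[of _ n])
  qed
qed

section \<open>Heights in a deterministic tree\<close>

locale stick_positions =
  fixes l :: "nat \<Rightarrow> real" and v :: "nat \<Rightarrow> nat \<times> real"
  assumes l_pos: "\<And>i. i \<ge> 1 \<Longrightarrow> 0 < l i"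
    and v_in: "\<And>i. i \<ge> 1 \<Longrightarrow> v i \<in> stick_points l i"
begin

definition height :: "nat \<times> real \<Rightarrow> real" where
  "height p = mdist (stick_union l v) stick_root p"

lemma mspace_union: "mspace (stick_union l v) = (\<Union>n\<in>{1..}. stick_points l n)"
proof -
  have "mspace (stick_tree l v n) = stick_points l n" if "n \<ge> 1" for n
    using mspace_stick_tree[of l v "n - 1"] l_pos v_in that by simp
  then show ?thesis
    using mspace_stick_union[of l v] l_pos v_in by simp
qed

lemma stick_root_in: "stick_root \<in> stick_points l n"
  by (simp add: stick_points_def)

lemma height_eq_mdist:
  assumes "p \<in> stick_points l n" "n \<ge> 1"
  shows "height p = mdist (stick_tree l v n) stick_root p"
  unfolding height_def using mdist_stick_union[of l v] mdist_stick_tree_max[of l v stick_root n p]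
    l_pos v_in assms stick_root_in by simp

lemma rooted_height_eq:
  "rooted_height (stick_limit l v) = (SUP p\<in>(\<Union>n\<in>{1..}. stick_points l n). ennreal (height p))"
proof -
  have "stick_root \<in> mspace (stick_union l v)"
    using stick_root_in mspace_union by auto
  then have "rooted_height (stick_limit l v) = rooted_height (stick_union l v, stick_root)"
    unfolding stick_limit_def by (rule rooted_height_completion)
  then show ?thesis by (simp add: rooted_height_def mspace_union height_def)
qed

lemma height_le_rooted_height:
  "p \<in> stick_points l n \<Longrightarrow> n \<ge> 1 \<Longrightarrow> ennreal (height p) \<le> rooted_height (stick_limit l v)"
  unfolding rooted_height_eq by (rule SUP_upper) auto

lemma height_nonneg: "0 \<le> height p"
  by (simp add: height_def)

lemma height_first:
  assumes "0 \<le> s" "s \<le> l 1"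
  shows "height (1, s) = s"
proof -
  have "(1, s) \<in> stick_points l 1"
    using assms by (auto simp: stick_points_def stick_root_def)
  from height_eq_mdist[OF this] show ?thesis
    using assms by (simp add: Metric_space.mdist_metric[OF Metric_space_segment] stick_root_def)
qed

text \<open>
  The recursion that carries all height estimates: the path from the root enters a new stick
  through its attachment point.
\<close>

lemma height_Suc:
  assumes k: "k \<ge> 1" and s: "0 < s" "s \<le> l (Suc k)"
  shows "height (Suc k, s) = height (v k) + s"
proof -
  obtain n where n: "k = Suc n" using k by (cases k) auto
  have "(Suc k, s) \<in> stick_points l (Suc k)"
    using s by (auto simp: stick_points_def)
  moreover have "(Suc k, s) \<notin> stick_points l k"
    using s by (auto simp: stick_points_def stick_root_def)
  ultimately show ?thesis
    using height_eq_mdist[of "(Suc k, s)" "Suc k"] height_eq_mdist[OF v_in[OF k] k] s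
      mdist_stick_tree_Suc_Suc[of l v n stick_root "(Suc k, s)"] l_pos v_in stick_root_in[of k]
    by (simp add: n del: stick_tree.simps)
qed

lemma v_cases:
  assumes "k \<ge> 1"
  obtains j s where "v k = (j, s)" "1 \<le> j" "j \<le> k" "0 \<le> s" "s \<le> l j" "s = 0 \<Longrightarrow> j = 1"
  using v_in[OF assms] assms l_pos[of 1]
  by (cases "v k") (auto simp: stick_points_def stick_root_def less_imp_le)


text \<open>
  Each generation occurs at most once on a path to the root, so a bound on stick lengths in terms
  of the generation bounds the height by a single series.
\<close>

lemma height_le_sum_generations:
  assumes b: "\<And>k. k \<ge> 1 \<Longrightarrow> l k \<le> b (generation (\<lambda>i. fst (v i)) k)"
    and "k \<ge> 1" "0 \<le> s" "s \<le> l k" "s = 0 \<Longrightarrow> k = 1"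
  shows "height (k, s) \<le> (\<Sum>i\<le>generation (\<lambda>i. fst (v i)) k. b i)"
  using assms(2-)
proof (induction k arbitrary: s rule: less_induct)
  case (less k)
  let ?gen = "generation (\<lambda>i. fst (v i))"
  show ?case
  proof (cases "k = 1")
    case True
    then show ?thesis
      using less.prems b[of 1] height_first[of s] by (simp add: generation.simps[of _ "Suc 0"])
  next
    case False
    then obtain i where i: "k = Suc i" "i \<ge> 1"
      using less.prems(1) by (cases k) auto
    obtain j t where v: "v i = (j, t)" "1 \<le> j" "j \<le> i" "0 \<le> t" "t \<le> l j" "t = 0 \<Longrightarrow> j = 1"
      using v_cases[OF i(2)] by blast
    have gen: "?gen k = Suc (?gen j)"
      using i v(1-3) by (subst generation.simps) simp
    have "height (k, s) = height (j, t) + s"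
      using height_Suc[OF i(2), of s] less.prems False i(1) v(1) by fastforce
    also have "\<dots> \<le> (\<Sum>i\<le>?gen j. b i) + b (?gen k)"
      using less.IH[of j t] v i less.prems b[of k] by (intro add_mono) auto
    finally show ?thesis by (simp add: gen)
  qed
qed

lemma rooted_height_finite:
  assumes b: "\<And>k. k \<ge> 1 \<Longrightarrow> l k \<le> b (generation (\<lambda>i. fst (v i)) k)"
    and nonneg: "\<And>i. 0 \<le> b i" and sum: "summable b"
  shows "rooted_height (stick_limit l v) < \<infinity>"
proof -
  have "height p \<le> suminf b" if "p \<in> stick_points l n" "n \<ge> 1" for p n
  proof -
    obtain k s where p: "p = (k, s)" by (cases p)
    have "k \<ge> 1" "0 \<le> s" "s \<le> l k" "s = 0 \<Longrightarrow> k = 1"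
      using that l_pos[of 1] by (auto simp: p stick_points_def stick_root_def)
    from height_le_sum_generations[OF b this] show ?thesis
      unfolding p using sum_le_suminf[OF sum, of "{..generation (\<lambda>i. fst (v i)) k}"] nonneg
      by fastforce
  qed
  then have "rooted_height (stick_limit l v) \<le> ennreal (suminf b)"
    unfolding rooted_height_eq by (intro SUP_least ennreal_leI) auto
  then show ?thesis using ennreal_less_top[of "suminf b"] by (simp add: le_less_trans)
qed

text \<open>
  A stick that sits on the outer half of a stick \<open>j\<close> starts at least \<open>l j / 2\<close> higher than \<open>j\<close> does.
\<close>

lemma height_ge_of_climbers:
  assumes a: "\<And>r. a r \<ge> 1"
    and w: "\<And>r j. j \<in> {a r<..a (Suc r)} \<Longrightarrow> w r \<le> l j"
    and n: "n \<in> climbers a (\<lambda>i. stick_code l (v i)) r"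
  shows "(\<Sum>i<r. w i) / 2 \<le> height (v (n - 1))"
  using n
proof (induction r arbitrary: n)
  case 0
  show ?case by (simp add: height_nonneg)
next
  case (Suc r)
  define j where "j = fst (v (n - 1))"
  define t where "t = snd (v (n - 1))"
  have v: "v (n - 1) = (j, t)" by (simp add: j_def t_def)
  have n: "n > a (Suc r)" and j: "j \<in> climbers a (\<lambda>i. stick_code l (v i)) r" and t: "l j / 2 < t"
    using Suc.prems by (auto simp: stick_code_def j_def t_def)
  have jblock: "j \<in> {a r<..a (Suc r)}"
    using j by (cases r) auto
  \<comment> \<open>All blocks avoid stick 1, whose lower end is the root rather than an attachment point.\<close>
  then have j1: "j > 1" using a[of r] by auto
  have "n - 1 \<ge> 1" using n a[of "Suc r"] by auto
  from v_in[OF this] v t j1 l_pos[of j] have "0 < t" "t \<le> l j"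
    by (auto simp: stick_points_def stick_root_def)
  then have "height (v (n - 1)) = height (v (j - 1)) + t"
    using height_Suc[of "j - 1" t] j1 v by simp
  moreover have "w r / 2 \<le> t"
    using w[OF jblock] t by simp
  ultimately show ?case
    using Suc.IH[OF j] by (simp add: add_divide_distrib)
qed

lemma rooted_height_ge_of_climbers:
  assumes a: "\<And>r. a r \<ge> 1"
    and w: "\<And>r j. j \<in> {a r<..a (Suc r)} \<Longrightarrow> w r \<le> l j"
    and ne: "climbers a (\<lambda>i. stick_code l (v i)) r \<noteq> {}"
  shows "ennreal ((\<Sum>i<r. w i) / 2) \<le> rooted_height (stick_limit l v)"
proof -
  obtain n where n: "n \<in> climbers a (\<lambda>i. stick_code l (v i)) r"
    using ne by blast
  have "n > a r" using n by (cases r) auto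
  then have "n - 1 \<ge> 1" using a[of r] by auto
  from height_le_rooted_height[OF v_in[OF this] this] height_ge_of_climbers[OF a w n]
  show ?thesis by (meson ennreal_leI order_trans)
qed

end

section \<open>Blocks of a decreasing sequence of lengths\<close>

locale decreasing_lengths =
  fixes l :: "nat \<Rightarrow> real"
  assumes l_pos: "\<And>i. i \<ge> 1 \<Longrightarrow> 0 < l i"
    and l_mono: "\<And>i j. 1 \<le> i \<Longrightarrow> i \<le> j \<Longrightarrow> l j \<le> l i"
begin

definition total :: "nat \<Rightarrow> real" where
  "total n = (\<Sum>i=1..n. l i)"

lemma total_Suc: "total (Suc n) = total n + l (Suc n)"
  by (simp add: total_def)

lemma total_mono: "i \<le> j \<Longrightarrow> total i \<le> total j"
  unfolding total_def using l_pos by (intro sum_mono2) (auto simp: less_imp_le)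

lemma total_pos: "i \<ge> 1 \<Longrightarrow> 0 < total i"
  unfolding total_def using l_pos by (intro sum_pos) auto

lemma total_le: "total n \<le> real n * l 1"
  using sum_bounded_above[of "{1..n}" l "l 1"] l_mono[of 1] by (simp add: total_def)

lemma total_ge: "n \<ge> 1 \<Longrightarrow> real n * l n \<le> total n"
  using sum_bounded_below[of "{1..n}" "l n" l] l_mono[of _ n] by (simp add: total_def)

lemma total_add_le:
  assumes "a \<ge> 1" "a \<le> b"
  shows "total b \<le> total a + real (b - a) * l a"
  using assms(2)
proof (induction rule: dec_induct)
  case (step n)
  then show ?case
    using l_mono[of a "Suc n"] assms(1) by (simp add: total_Suc algebra_simps Suc_diff_le)
qed simp

text \<open>
  The parent of stick \<open>n + 1\<close> is \<open>j\<close> with probability \<open>l j / total n\<close>; as \<open>l\<close> decreases, Chebyshev's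
  sum inequality makes its mean index at most that of a uniform choice from \<open>{1..n}\<close>.
\<close>

lemma weighted_index_le: "(\<Sum>j=1..n. l j * real j) \<le> total n * (real n + 1) / 2"
proof (cases "n = 0")
  case False
  have shift: "(\<Sum>k=0..<n. f (Suc k)) = (\<Sum>j=1..n. f j)" for f :: "nat \<Rightarrow> real"
    by (rule sum.reindex_bij_witness[of _ "\<lambda>j. j - 1" Suc]) auto
  have "real n * (\<Sum>k=0..<n. real (Suc k) * l (Suc k))
      \<le> (\<Sum>k=0..<n. real (Suc k)) * (\<Sum>k=0..<n. l (Suc k))"
    using l_mono by (intro Chebyshev_sum_upper) auto
  also have "(\<Sum>k=0..<n. real (Suc k)) = real n * (real n + 1) / 2"
    by (induction n) (auto simp: field_simps)
  finally have "real n * (\<Sum>j=1..n. l j * real j) \<le> real n * (total n * (real n + 1) / 2)"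
    unfolding shift[of "\<lambda>j. real j * l j"] shift[of l] by (simp add: total_def algebra_simps)
  then show ?thesis using False by simp
qed (simp add: total_def)

definition avg :: "nat \<Rightarrow> real" where
  "avg n = total n / real n"

lemma avg_nonneg: "0 \<le> avg n"
  using total_mono[of 0 n] by (simp add: avg_def total_def)

lemma l_le_avg: "n \<ge> 1 \<Longrightarrow> l n \<le> avg n"
  using total_ge[of n] by (simp add: avg_def field_simps)

lemma avg_mono:
  assumes "1 \<le> i" "i \<le> j"
  shows "avg j \<le> avg i"
  using assms(2)
proof (induction rule: dec_induct)
  case (step n)
  have n: "n \<ge> 1" using step assms by simp
  have "real n * l (Suc n) \<le> real n * l n"
    using l_mono[of n "Suc n"] n by (intro mult_left_mono) auto
  then have "real n * l (Suc n) \<le> total n"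
    using total_ge[OF n] by linarith
  then have "avg (Suc n) \<le> avg n"
    using n by (simp add: avg_def total_Suc field_simps)
  then show ?case using step by simp
qed simp

text \<open>
  The expected number of children that a stick of length \<open>l a\<close> receives from the attachments
  \<open>a, \<dots>, b - 1\<close>.
\<close>

definition exposure :: "nat \<Rightarrow> nat \<Rightarrow> real" where
  "exposure a b = l a * (\<Sum>i=a..<b. 1 / total i)"

text \<open>The total length grows at most linearly, so the exposure dominates a harmonic series.\<close>

lemma exposure_unbounded:
  assumes "a \<ge> 1"
  shows "\<exists>b. 4 \<le> exposure a b"
proof (rule ccontr)
  assume "\<not> ?thesis"
  then have small: "exposure a b < 4" for b by (auto simp: not_le)
  let ?f = "\<lambda>i. 1 / total (i + a)"
  have tot: "0 < total (i + a)" for i using total_pos[of "i + a"] assms by simp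
  have la: "0 < l a" and l1: "0 < l 1" using l_pos assms by auto
  have "summable ?f"
  proof (rule summableI_nonneg_bounded[where x = "4 / l a"])
    fix n
    have "(\<Sum>i<n. ?f i) = (\<Sum>i=a..<n + a. 1 / total i)"
      using sum.shift_bounds_nat_ivl[of "\<lambda>i. 1 / total i" 0 a n] by (simp add: lessThan_atLeast0)
    also have "\<dots> \<le> 4 / l a"
      using small[of "n + a"] la by (simp add: exposure_def field_simps)
    finally show "(\<Sum>i<n. ?f i) \<le> 4 / l a" .
  qed (use tot in \<open>auto simp: less_imp_le\<close>)
  then have "summable (\<lambda>i. l 1 * ?f i)" by (rule summable_mult)
  then have "summable (\<lambda>i. 1 / real (i + a))"
  proof (rule summable_comparison_test')
    fix n
    show "norm (1 / real (n + a)) \<le> l 1 * ?f n"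
      using total_le[of "n + a"] tot[of n] l1 assms by (simp add: field_simps)
  qed
  then have "summable (\<lambda>i. 1 / real i)"
    using summable_iff_shift[of "\<lambda>i. 1 / real i" a] by simp
  then show False
    using not_summable_harmonic[where 'a = real] by (simp add: inverse_eq_divide)
qed

definition next_time :: "nat \<Rightarrow> nat" where
  "next_time a = (LEAST b. 4 \<le> exposure a b)"

context
  fixes a :: nat assumes a: "a \<ge> 1"
begin

lemma exposure_next_time: "4 \<le> exposure a (next_time a)"
  unfolding next_time_def using exposure_unbounded[OF a] by (rule LeastI_ex)

lemma exposure_before: "b < next_time a \<Longrightarrow> exposure a b < 4"
  unfolding next_time_def using not_less_Least by (metis not_le)

text \<open>
  From time \<open>a\<close> on the total length is at least \<open>a * l a\<close>, so one attachment adds at most \<open>1 / a\<close> to the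
  exposure.
\<close>

lemma next_time_ge: "5 * a \<le> next_time a"
proof -
  let ?b = "next_time a"
  have la: "0 < l a" using l_pos a by auto
  have tot: "0 < real a * l a" using a la by simp
  have "4 \<le> exposure a ?b" by (rule exposure_next_time)
  also have "(\<Sum>i=a..<?b. 1 / total i) \<le> (\<Sum>i=a..<?b. 1 / (real a * l a))"
    using total_mono[of a] total_ge[OF a] tot by (intro sum_mono divide_left_mono) fastforce+
  then have "exposure a ?b \<le> l a * (\<Sum>i=a..<?b. 1 / (real a * l a))"
    unfolding exposure_def using la by (intro mult_left_mono) auto
  also have "\<dots> = real (?b - a) / real a"
    using la a by simp
  finally have "4 * real a \<le> real (?b - a)"
    using a by (simp add: field_simps)
  then have "4 * a \<le> ?b - a" by linarith
  then show ?thesis using a by linarith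
qed

text \<open>
  The sticks up to \<open>a\<close> make up at most a fifth of those up to \<open>next_time a\<close>, and the later ones are
  no longer than \<open>l a\<close>.
\<close>

lemma avg_next_time: "avg (next_time a) \<le> avg a / 5 + l a"
proof -
  let ?b = "next_time a"
  have b: "real ?b \<ge> 5 * real a" using next_time_ge by linarith
  have pos: "real a > 0" "real ?b > 0" using a b by auto
  have la: "0 < l a" using l_pos a by auto
  have "avg ?b \<le> (total a + real (?b - a) * l a) / real ?b"
    unfolding avg_def using total_add_le[OF a, of ?b] next_time_ge pos
    by (intro divide_right_mono) auto
  also have "\<dots> = total a / real ?b + (real (?b - a) / real ?b) * l a"
    by (simp add: add_divide_distrib)
  also have "\<dots> \<le> total a / (5 * real a) + 1 * l a"
    using b pos la total_pos[OF a]
    by (intro add_mono divide_left_mono mult_right_mono) auto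
  finally show ?thesis by (simp add: avg_def)
qed

text \<open>
  Since \<open>1 / i = avg i / total i \<le> avg a / total i\<close>, the harmonic mass of a block is its exposure
  times \<open>avg a\<close> up to the factor \<open>l a\<close>, and minimality keeps the exposure below 4 up to the last
  attachment, which contributes the fifth \<open>avg a\<close>.
\<close>

lemma block_sum_le: "(\<Sum>n\<in>{a<..next_time a}. l n / real n) \<le> 5 * avg a"
proof -
  let ?b = "next_time a"
  have la: "0 < l a" using l_pos a by auto
  define c where "c = ?b - 1"
  have c: "?b = Suc c" "a \<le> c" using next_time_ge a by (auto simp: c_def)
  have "(\<Sum>n\<in>{a<..c}. l n / real n) \<le> (\<Sum>n\<in>{a<..c}. l a / real (n - 1))"
    using l_mono[of a] a la by (intro sum_mono frac_le) auto
  also have "\<dots> = (\<Sum>i=a..<c. l a / real i)"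
    by (rule sum.reindex_bij_witness[of _ Suc "\<lambda>n. n - 1"]) auto
  also have "\<dots> \<le> (\<Sum>i=a..<c. avg a * (l a * (1 / total i)))"
  proof (rule sum_mono)
    fix i assume "i \<in> {a..<c}"
    then have i: "a \<le> i" "1 \<le> i" using a by auto
    have "l a / real i = avg i * (l a * (1 / total i))"
      using total_pos[OF i(2)] i by (simp add: avg_def)
    also have "\<dots> \<le> avg a * (l a * (1 / total i))"
      using avg_mono[OF a i(1)] la total_pos[OF i(2)] by (intro mult_right_mono) auto
    finally show "l a / real i \<le> avg a * (l a * (1 / total i))" .
  qed
  also have "\<dots> = avg a * exposure a c"
    by (simp add: exposure_def sum_distrib_left)
  also have "\<dots> \<le> avg a * 4"
    using exposure_before[of c] c avg_nonneg by (intro mult_left_mono) auto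
  finally have "(\<Sum>n\<in>{a<..c}. l n / real n) \<le> avg a * 4" .
  moreover have "l ?b / real ?b \<le> avg a"
  proof -
    have "l ?b / real ?b \<le> l ?b"
      using l_pos[of ?b] c by (simp add: divide_le_eq mult_le_cancel_left1)
    also have "\<dots> \<le> avg a"
      using l_mono[OF a, of ?b] l_le_avg[OF a] c by simp
    finally show ?thesis .
  qed
  moreover have "{a<..?b} = insert ?b {a<..c}"
    using c by auto
  ultimately show ?thesis using c by simp
qed

end

definition block_time :: "nat \<Rightarrow> nat" where
  "block_time r = (next_time ^^ r) 1"

lemma block_time_0: "block_time 0 = 1" and block_time_Suc: "block_time (Suc r) = next_time (block_time r)"
  by (simp_all add: block_time_def)

lemma block_time_ge_1: "block_time r \<ge> 1"
proof (induction r)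
  case (Suc r)
  then show ?case using next_time_ge[OF Suc] by (simp add: block_time_Suc)
qed (simp add: block_time_0)

lemma block_time_less: "block_time r < block_time (Suc r)"
  using next_time_ge[OF block_time_ge_1, of r] block_time_ge_1[of r] by (simp add: block_time_Suc)

text \<open>
  The contraction of \<open>avg\<close> along the block times, summed up; the boundary term on the left is what
  makes the induction go through.
\<close>

lemma sum_avg_block_time:
  "4 * (\<Sum>r<R. avg (block_time r)) + 5 * avg (block_time R)
     \<le> 5 * (avg 1 + (\<Sum>r<R. l (block_time r)))"
proof (induction R)
  case (Suc R)
  then show ?case
    using avg_next_time[OF block_time_ge_1, of R] by (simp add: block_time_Suc)
qed (simp add: block_time_0)

lemma sum_le_sum_avg_block_time:
  "(\<Sum>n\<in>{1<..block_time R}. l n / real n) \<le> 5 * (\<Sum>r<R. avg (block_time r))"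
proof (induction R)
  case (Suc R)
  have "{1<..block_time (Suc R)} = {1<..block_time R} \<union> {block_time R<..block_time (Suc R)}"
    using block_time_less[of R] block_time_ge_1[of R] by auto
  then have "(\<Sum>n\<in>{1<..block_time (Suc R)}. l n / real n) =
      (\<Sum>n\<in>{1<..block_time R}. l n / real n) + (\<Sum>n\<in>{block_time R<..block_time (Suc R)}. l n / real n)"
    by (simp add: sum.union_disjoint ivl_disj_int)
  then show ?case
    using Suc block_sum_le[OF block_time_ge_1, of R] by (simp add: block_time_Suc)
qed (simp add: block_time_0)

lemma summable_if_summable_block_time:
  assumes "summable (\<lambda>r. l (block_time r))"
  shows "summable (\<lambda>n. l n / real n)"
proof -
  define S where "S = (\<Sum>r. l (block_time r))"
  have le_S: "(\<Sum>r<R. l (block_time r)) \<le> S" for R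
    unfolding S_def using l_pos block_time_ge_1
    by (intro sum_le_suminf[OF assms]) (auto simp: less_imp_le)
  have "(\<Sum>n<N. l (Suc n) / real (Suc n)) \<le> l 1 + 25 / 4 * (avg 1 + S)" for N
  proof -
    have "strict_mono block_time"
      using block_time_less by (rule strict_monoI_Suc)
    then have N: "N \<le> block_time N" by (rule strict_mono_imp_increasing)
    have "(\<Sum>n<N. l (Suc n) / real (Suc n)) = (\<Sum>n\<in>{1..N}. l n / real n)"
      by (rule sum.reindex_bij_witness[of _ "\<lambda>n. n - 1" Suc]) auto
    also have "\<dots> \<le> (\<Sum>n\<in>insert 1 {1<..block_time N}. l n / real n)"
      using N l_pos by (intro sum_mono2) (auto simp: less_imp_le)
    also have "\<dots> = l 1 + (\<Sum>n\<in>{1<..block_time N}. l n / real n)" by simp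
    also have "\<dots> \<le> l 1 + 25 / 4 * (avg 1 + S)"
      using sum_le_sum_avg_block_time[of N] sum_avg_block_time[of N] le_S[of N]
        avg_nonneg[of "block_time N"] by (simp add: field_simps)
    finally show ?thesis .
  qed
  then have "summable (\<lambda>n. l (Suc n) / real (Suc n))"
    using l_pos by (intro summableI_nonneg_bounded) (auto simp: less_imp_le)
  then show ?thesis by (subst (asm) summable_Suc_iff)
qed

lemma summable_iff_condensed:
  "summable (\<lambda>n. l n / real n) \<longleftrightarrow> summable (\<lambda>n. l (2 ^ n))"
proof -
  have "summable (\<lambda>n. l n / real n) \<longleftrightarrow> summable (\<lambda>n. 2 ^ n * (l (2 ^ n) / real (2 ^ n)))"
  proof (rule condensation_test)
    show "l (Suc m) / real (Suc m) \<le> l m / real m" if "0 < m" for m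
      using that l_mono[of m "Suc m"] l_pos[of m] by (intro frac_le) auto
    show "0 \<le> l n / real n" for n
      using l_pos[of n] by (cases "n = 0") (auto simp: less_imp_le)
  qed
  then show ?thesis by simp
qed

end

section \<open>Independence of the attachments\<close>

locale decreasing_stick_breaking = stick_breaking M l X + decreasing_lengths l
  for M :: "'w measure" and l :: "nat \<Rightarrow> real" and X :: "nat \<Rightarrow> 'w \<Rightarrow> nat \<times> real"
begin

lemma X_measurable [measurable]: "i \<ge> 1 \<Longrightarrow> X i \<in> measurable M stick_length_measure"
  using indep by (auto simp: indep_vars_def)

lemma segment_sets: "A \<in> sets borel \<Longrightarrow> {j} \<times> A \<in> sets stick_length_measure"
  by (auto simp: stick_length_measure_def)

lemma emeasure_segment:
  assumes "c \<le> d"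
  shows "emeasure stick_length_measure ({j} \<times> {c<..d}) = ennreal (d - c)"
  unfolding stick_length_measure_def using assms
  by (subst lborel.emeasure_pair_measure_Times) auto

lemma prob_segment:
  assumes i: "i \<ge> 1" and j: "1 \<le> j" "j \<le> i" and c: "0 \<le> c" "c \<le> l j"
  shows "prob {\<omega> \<in> space M. X i \<omega> \<in> {j} \<times> {c<..l j}} = (l j - c) / total i"
proof -
  let ?S = stick_length_measure and ?P = "stick_points l i" and ?A = "{j} \<times> {c<..l j}"
  have P: "emeasure ?S ?P = ennreal (total i)"
    unfolding total_def using l_pos by (rule emeasure_stick_points)
  \<comment> \<open>A set of nonzero measure is measurable, because the measure vanishes off the sigma-algebra.\<close>
  then have "?P \<in> sets ?S"
    using emeasure_notin_sets[of ?P ?S] total_pos[OF i] by (auto simp: ennreal_eq_0_iff)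
  moreover have A: "?A \<in> sets ?S" by (rule segment_sets) auto
  ultimately have "emeasure (uniform_measure ?S ?P) ?A = emeasure ?S (?P \<inter> ?A) / emeasure ?S ?P"
    by (rule emeasure_uniform_measure)
  also have "?P \<inter> ?A = ?A"
    using j c by (auto simp: stick_points_def)
  also have "emeasure ?S ?A / emeasure ?S ?P = ennreal ((l j - c) / total i)"
    using P c total_pos[OF i] by (simp add: emeasure_segment divide_ennreal)
  also have "uniform_measure ?S ?P = distr M ?S (X i)"
    using uniform[OF i] by simp
  also have "emeasure (distr M ?S (X i)) ?A = emeasure M {\<omega> \<in> space M. X i \<omega> \<in> ?A}"
    using emeasure_distr[OF X_measurable[OF i] A] by (simp add: vimage_def Int_def conj_commute)
  finally show ?thesis
    using c total_pos[OF i] by (simp add: measure_def)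
qed

lemma segment_event [measurable]:
  assumes "i \<ge> 1"
  shows "{\<omega> \<in> space M. X i \<omega> \<in> {j} \<times> {c<..d}} \<in> sets M"
  using measurable_sets[OF X_measurable[OF assms] segment_sets[of "{c<..d}" j]]
  by (simp add: vimage_def Int_def conj_commute)

text \<open>
  The half-open sticks carry all of the length, so a.s. no attachment happens at the root.
\<close>

lemma AE_X_in_segments:
  assumes i: "i \<ge> 1"
  shows "AE \<omega> in M. X i \<omega> \<in> (SIGMA j:{1..i}. {0<..l j})"
proof -
  let ?E = "\<lambda>j. {\<omega> \<in> space M. X i \<omega> \<in> {j} \<times> {0<..l j}}"
  have "prob (\<Union>j\<in>{1..i}. ?E j) = (\<Sum>j=1..i. prob (?E j))"
    using segment_event[OF i] by (intro finite_measure_finite_Union) (auto simp: disjoint_family_on_def)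
  also have "\<dots> = (\<Sum>j=1..i. l j / total i)"
    using prob_segment[OF i, of _ 0] l_pos by (intro sum.cong) (auto simp: less_imp_le)
  also have "\<dots> = 1"
    using total_pos[OF i] by (simp add: total_def flip: sum_divide_distrib)
  finally have "AE \<omega> in M. \<omega> \<in> (\<Union>j\<in>{1..i}. ?E j)"
    by (rule AE_prob_1)
  then show ?thesis by eventually_elim auto
qed

lemma AE_stick_positions: "AE \<omega> in M. stick_positions l (\<lambda>i. X i \<omega>)"
proof -
  have "AE \<omega> in M. X i \<omega> \<in> (SIGMA j:{1..i}. {0<..l j})" if "i \<in> {1..}" for i
    using AE_X_in_segments that by simp
  then have "AE \<omega> in M. \<forall>i\<in>{1..}. X i \<omega> \<in> (SIGMA j:{1..i}. {0<..l j})"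
    by (subst AE_ball_countable) auto
  then show ?thesis
  proof eventually_elim
    case (elim \<omega>)
    then have "X i \<omega> \<in> stick_points l i" if "i \<ge> 1" for i
      using that by (fastforce simp: stick_points_def)
    then show ?case using l_pos by unfold_locales
  qed
qed

definition code :: "'w \<Rightarrow> nat \<Rightarrow> nat \<times> bool" where
  "code \<omega> i = stick_code l (X i \<omega>)"

lemma measurable_stick_code: "stick_code l \<in> measurable stick_length_measure (count_space UNIV)"
proof -
  have "(\<lambda>p. (fst p, l (fst p) / 2 < snd p))
      \<in> measurable stick_length_measure (count_space UNIV \<Otimes>\<^sub>M count_space UNIV)"
    unfolding stick_length_measure_def by measurable
  also have "count_space UNIV \<Otimes>\<^sub>M count_space UNIV = (count_space UNIV :: (nat \<times> bool) measure)"
    by (subst pair_measure_countable) auto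
  finally show ?thesis by (simp add: stick_code_def[abs_def])
qed

lemma indep_code: "indep_vars (\<lambda>_. count_space UNIV) (\<lambda>i \<omega>. code \<omega> i) {1..}"
  unfolding code_def using indep measurable_stick_code by (rule indep_vars_compose2)

lemma PiM_codes:
  assumes "finite A"
  shows "PiM A (\<lambda>_. count_space (UNIV :: (nat \<times> bool) set)) = count_space (PiE A (\<lambda>_. UNIV))"
  using assms by (rule count_space_PiM_finite) auto

lemma measurable_restrict_code:
  assumes "A \<subseteq> {1..}"
  shows "(\<lambda>\<omega>. restrict (code \<omega>) A) \<in> measurable M (PiM A (\<lambda>_. count_space UNIV))"
  using indep_code assms by (intro measurable_restrict) (auto simp: indep_vars_def)

lemma measurable_finitely_determined:
  assumes "finite A" "A \<subseteq> {1..}"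
    and F: "\<And>x y. (\<And>i. i \<in> A \<Longrightarrow> x i = y i) \<Longrightarrow> F x = F y" and "\<And>x. F x \<in> space N"
  shows "(\<lambda>\<omega>. F (code \<omega>)) \<in> measurable M N"
proof -
  have "F \<in> measurable (PiM A (\<lambda>_. count_space UNIV)) N"
    using assms(1,4) by (simp add: PiM_codes)
  from measurable_compose[OF measurable_restrict_code[OF assms(2)] this]
  have "(\<lambda>\<omega>. F (restrict (code \<omega>) A)) \<in> measurable M N" .
  also have "(\<lambda>\<omega>. F (restrict (code \<omega>) A)) = (\<lambda>\<omega>. F (code \<omega>))"
    by (rule ext, rule F) simp
  finally show ?thesis .
qed

text \<open>
  Fubini's theorem for two disjoint finite groups of attachments: a quantity that depends on both
  may be averaged over the second group with the first one held fixed.  This is the only form in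
  which independence of past and future enters.
\<close>

lemma nn_integral_independent_codes:
  fixes F :: "(nat \<Rightarrow> nat \<times> bool) \<Rightarrow> (nat \<Rightarrow> nat \<times> bool) \<Rightarrow> ennreal"
  assumes fin: "finite A" "finite B" and sub: "A \<subseteq> {1..}" "B \<subseteq> {1..}" and disj: "A \<inter> B = {}"
    and F: "\<And>x x' y y'. (\<And>i. i \<in> A \<Longrightarrow> x i = x' i) \<Longrightarrow> (\<And>i. i \<in> B \<Longrightarrow> y i = y' i) \<Longrightarrow> F x y = F x' y'"
  shows "(\<integral>\<^sup>+\<omega>. F (code \<omega>) (code \<omega>) \<partial>M) = (\<integral>\<^sup>+\<omega>. (\<integral>\<^sup>+\<omega>'. F (code \<omega>) (code \<omega>') \<partial>M) \<partial>M)"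
proof -
  let ?P = "\<lambda>A. PiM A (\<lambda>_. count_space (UNIV :: (nat \<times> bool) set))"
  let ?R = "\<lambda>A \<omega>. restrict (code \<omega>) A"
  note meas = measurable_restrict_code[OF sub(1)] measurable_restrict_code[OF sub(2)]
  have ind: "indep_var (?P A) (?R A) (?P B) (?R B)"
    using indep_var_restrict[OF indep_code disj sub] by simp
  interpret B: prob_space "distr M (?P B) (?R B)"
    by (rule prob_space_distr[OF meas(2)])
  have count: "?P A \<Otimes>\<^sub>M ?P B = count_space (PiE A (\<lambda>_. UNIV) \<times> PiE B (\<lambda>_. UNIV))"
    unfolding PiM_codes[OF fin(1)] PiM_codes[OF fin(2)] using fin
    by (intro pair_measure_countable countable_PiE) auto
  have F_meas: "(\<lambda>(x, y). F x y) \<in> borel_measurable (?P A \<Otimes>\<^sub>M ?P B)"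
    unfolding count by simp
  have FR: "F (?R A \<omega>) (?R B \<omega>') = F (code \<omega>) (code \<omega>')" for \<omega> \<omega>'
    by (rule F) auto
  have "(\<integral>\<^sup>+\<omega>. F (code \<omega>) (code \<omega>) \<partial>M) = (\<integral>\<^sup>+\<omega>. (\<lambda>(x, y). F x y) (?R A \<omega>, ?R B \<omega>) \<partial>M)"
    by (simp add: FR)
  also have "\<dots> = (\<integral>\<^sup>+z. (\<lambda>(x, y). F x y) z \<partial>distr M (?P A \<Otimes>\<^sub>M ?P B) (\<lambda>\<omega>. (?R A \<omega>, ?R B \<omega>)))"
    using F_meas by (intro nn_integral_distr[symmetric] measurable_Pair meas) simp_all
  also have "\<dots> = (\<integral>\<^sup>+z. (\<lambda>(x, y). F x y) z \<partial>(distr M (?P A) (?R A) \<Otimes>\<^sub>M distr M (?P B) (?R B)))"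
    using ind by (simp add: indep_var_distribution_eq)
  also have "\<dots> = (\<integral>\<^sup>+x. (\<integral>\<^sup>+y. F x y \<partial>distr M (?P B) (?R B)) \<partial>distr M (?P A) (?R A))"
    using F_meas by (subst B.nn_integral_fst[symmetric]) auto
  also have "\<dots> = (\<integral>\<^sup>+x. (\<integral>\<^sup>+\<omega>'. F x (?R B \<omega>') \<partial>M) \<partial>distr M (?P A) (?R A))"
    using fin by (intro nn_integral_cong nn_integral_distr meas) (simp add: PiM_codes)
  also have "\<dots> = (\<integral>\<^sup>+\<omega>. (\<integral>\<^sup>+\<omega>'. F (?R A \<omega>) (?R B \<omega>') \<partial>M) \<partial>M)"
    using fin by (intro nn_integral_distr meas) (simp add: PiM_codes)
  finally show ?thesis by (simp add: FR)
qed

section \<open>Generations grow logarithmically\<close>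

abbreviation gen :: "'w \<Rightarrow> nat \<Rightarrow> nat" where
  "gen \<omega> n \<equiv> generation (\<lambda>i. fst (X i \<omega>)) n"

lemma gen_code: "gen \<omega> n = generation (\<lambda>i. fst (code \<omega> i)) n"
  by (simp add: code_def stick_code_def)

lemma measurable_gen: "(\<lambda>\<omega>. f (gen \<omega> n)) \<in> borel_measurable M" for f :: "nat \<Rightarrow> ennreal"
  unfolding gen_code
proof (rule measurable_finitely_determined[of "{1..<n}"])
  fix x y :: "nat \<Rightarrow> nat \<times> bool" assume "\<And>i. i \<in> {1..<n} \<Longrightarrow> x i = y i"
  then have "generation (\<lambda>i. fst (x i)) n = generation (\<lambda>i. fst (y i)) n"
    by (intro generation_cong) simp
  then show "f (generation (\<lambda>i. fst (x i)) n) = f (generation (\<lambda>i. fst (y i)) n)" by simp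
qed auto

lemma nn_integral_parent:
  assumes i: "i \<ge> 1" and j: "1 \<le> j" "j \<le> i"
  shows "(\<integral>\<^sup>+\<omega>. of_bool (fst (X i \<omega>) = j) * 2 ^ gen \<omega> j \<partial>M)
    = ennreal (l j / total i) * (\<integral>\<^sup>+\<omega>. 2 ^ gen \<omega> j \<partial>M)"
proof -
  define F :: "(nat \<Rightarrow> nat \<times> bool) \<Rightarrow> (nat \<Rightarrow> nat \<times> bool) \<Rightarrow> ennreal" where
    "F = (\<lambda>x y. of_bool (fst (y i) = j) * 2 ^ generation (\<lambda>k. fst (x k)) j)"
  let ?E = "{\<omega> \<in> space M. X i \<omega> \<in> {j} \<times> {0<..l j}}"
  have Pj: "(\<integral>\<^sup>+\<omega>. of_bool (fst (X i \<omega>) = j) \<partial>M) = ennreal (l j / total i)"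
  proof -
    have "(\<integral>\<^sup>+\<omega>. of_bool (fst (X i \<omega>) = j) \<partial>M) = (\<integral>\<^sup>+\<omega>. indicator ?E \<omega> \<partial>M)"
    proof (rule nn_integral_cong_AE)
      show "AE \<omega> in M. of_bool (fst (X i \<omega>) = j) = (indicator ?E \<omega> :: ennreal)"
        using AE_X_in_segments[OF i] AE_space
        by eventually_elim (auto simp: indicator_def)
    qed
    also have "\<dots> = emeasure M ?E"
      using segment_event[OF i] by simp
    also have "\<dots> = ennreal (l j / total i)"
      using prob_segment[OF i j, of 0] l_pos[of j] j by (simp add: emeasure_eq_measure)
    finally show ?thesis .
  qed
  have "(\<integral>\<^sup>+\<omega>. of_bool (fst (X i \<omega>) = j) * 2 ^ gen \<omega> j \<partial>M) = (\<integral>\<^sup>+\<omega>. F (code \<omega>) (code \<omega>) \<partial>M)"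
    by (simp add: F_def code_def stick_code_def)
  also have "\<dots> = (\<integral>\<^sup>+\<omega>. (\<integral>\<^sup>+\<omega>'. F (code \<omega>) (code \<omega>') \<partial>M) \<partial>M)"
  proof (rule nn_integral_independent_codes[of "{1..<j}" "{i}"])
    fix x x' y y' :: "nat \<Rightarrow> nat \<times> bool"
    assume "\<And>k. k \<in> {1..<j} \<Longrightarrow> x k = x' k" "\<And>k. k \<in> {i} \<Longrightarrow> y k = y' k"
    then show "F x y = F x' y'"
      using generation_cong[of j "\<lambda>k. fst (x k)" "\<lambda>k. fst (x' k)"] by (simp add: F_def)
  qed (use i j in auto)
  also have "\<dots> = (\<integral>\<^sup>+\<omega>. (\<integral>\<^sup>+\<omega>'. of_bool (fst (X i \<omega>') = j) * 2 ^ gen \<omega> j \<partial>M) \<partial>M)"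
    by (simp add: F_def code_def stick_code_def)
  also have "\<dots> = (\<integral>\<^sup>+\<omega>. ennreal (l j / total i) * 2 ^ gen \<omega> j \<partial>M)"
  proof (intro nn_integral_cong)
    fix \<omega>
    have "(\<lambda>\<omega>'. of_bool (fst (code \<omega>' i) = j) :: ennreal) \<in> borel_measurable M"
      using i by (intro measurable_finitely_determined[of "{i}"]) auto
    then show "(\<integral>\<^sup>+\<omega>'. of_bool (fst (X i \<omega>') = j) * 2 ^ gen \<omega> j \<partial>M) = ennreal (l j / total i) * 2 ^ gen \<omega> j"
      by (subst nn_integral_multc) (simp_all add: code_def stick_code_def Pj)
  qed
  also have "\<dots> = ennreal (l j / total i) * (\<integral>\<^sup>+\<omega>. 2 ^ gen \<omega> j \<partial>M)"
    by (intro nn_integral_cmult measurable_gen)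
  finally show ?thesis .
qed

text \<open>
  By induction, the parent \<open>j\<close> of stick \<open>n\<close> contributes \<open>2 * 2 ^ gen j\<close>, of mean at most \<open>2 * j\<close>; and
  the mean of \<open>j\<close> is at most \<open>n / 2\<close>.  The base 2 is the one for which this closes up with a linear
  bound.
\<close>

lemma nn_integral_gen_le:
  "n \<ge> 1 \<Longrightarrow> (\<integral>\<^sup>+\<omega>. 2 ^ gen \<omega> n \<partial>M) \<le> ennreal (real n)"
proof (induction n rule: less_induct)
  case (less n)
  show ?case
  proof (cases "n = 1")
    case True
    then show ?thesis by (simp add: generation.simps[of _ "Suc 0"] emeasure_space_1)
  next
    case False
    then obtain i where n: "n = Suc i" and i: "i \<ge> 1"
      using less.prems by (cases n) auto
    have tot: "0 < total i" using total_pos[OF i] .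
    have meas: "(\<lambda>\<omega>. of_bool (fst (X i \<omega>) = j) * 2 ^ gen \<omega> j :: ennreal) \<in> borel_measurable M"
      if "j \<in> {1..i}" for j
    proof -
      have "(\<lambda>\<omega>. of_bool (fst (code \<omega> i) = j) :: ennreal) \<in> borel_measurable M"
        using i by (intro measurable_finitely_determined[of "{i}"]) auto
      then show ?thesis
        by (intro borel_measurable_times_ennreal measurable_gen) (simp add: code_def stick_code_def)
    qed
    have "(\<integral>\<^sup>+\<omega>. 2 ^ gen \<omega> n \<partial>M)
        = (\<integral>\<^sup>+\<omega>. 2 * (\<Sum>j=1..i. of_bool (fst (X i \<omega>) = j) * 2 ^ gen \<omega> j) \<partial>M)"
    proof (rule nn_integral_cong_AE)
      show "AE \<omega> in M. (2 ^ gen \<omega> n :: ennreal) = 2 * (\<Sum>j=1..i. of_bool (fst (X i \<omega>) = j) * 2 ^ gen \<omega> j)"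
        using AE_X_in_segments[OF i]
      proof eventually_elim
        case (elim \<omega>)
        then have J: "fst (X i \<omega>) \<in> {1..i}" by auto
        then have "gen \<omega> n = Suc (gen \<omega> (fst (X i \<omega>)))"
          using i by (subst generation.simps) (simp add: n)
        moreover have "(\<Sum>j=1..i. of_bool (fst (X i \<omega>) = j) * 2 ^ gen \<omega> j) = (2 ^ gen \<omega> (fst (X i \<omega>)) :: ennreal)"
          using J by (subst sum.remove[of _ "fst (X i \<omega>)"]) (auto intro!: sum.neutral)
        ultimately show ?case by simp
      qed
    qed
    also have "\<dots> = 2 * (\<integral>\<^sup>+\<omega>. (\<Sum>j=1..i. of_bool (fst (X i \<omega>) = j) * 2 ^ gen \<omega> j) \<partial>M)"
      using meas by (intro nn_integral_cmult borel_measurable_sum)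
    also have "(\<integral>\<^sup>+\<omega>. (\<Sum>j=1..i. of_bool (fst (X i \<omega>) = j) * 2 ^ gen \<omega> j) \<partial>M)
        = (\<Sum>j=1..i. \<integral>\<^sup>+\<omega>. of_bool (fst (X i \<omega>) = j) * 2 ^ gen \<omega> j \<partial>M)"
      using meas by (intro nn_integral_sum)
    also have "2 * (\<Sum>j=1..i. \<integral>\<^sup>+\<omega>. of_bool (fst (X i \<omega>) = j) * 2 ^ gen \<omega> j \<partial>M)
        = 2 * (\<Sum>j=1..i. ennreal (l j / total i) * (\<integral>\<^sup>+\<omega>. 2 ^ gen \<omega> j \<partial>M))"
      using i by (intro arg_cong2[where f = "(*)"] sum.cong nn_integral_parent) auto
    also have "\<dots> \<le> 2 * (\<Sum>j=1..i. ennreal (l j / total i) * ennreal (real j))"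
      using less.IH n by (intro mult_left_mono sum_mono) auto
    also have "(\<Sum>j=1..i. ennreal (l j / total i) * ennreal (real j)) = (\<Sum>j=1..i. ennreal (l j / total i * real j))"
      using l_pos tot by (intro sum.cong refl ennreal_mult[symmetric]) (auto simp: less_imp_le)
    also have "\<dots> = ennreal (\<Sum>j=1..i. l j / total i * real j)"
      using l_pos tot by (intro sum_ennreal) (auto simp: less_imp_le)
    also have "2 * \<dots> = ennreal (2 * (\<Sum>j=1..i. l j / total i * real j))"
      by (simp add: ennreal_mult')
    also have "\<dots> \<le> ennreal (real n)"
    proof (rule ennreal_leI)
      have "2 * (\<Sum>j=1..i. l j / total i * real j) = 2 * (\<Sum>j=1..i. l j * real j) / total i"
        by (simp add: sum_divide_distrib sum_distrib_left)
      also have "\<dots> \<le> real n"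
        using weighted_index_le[of i] tot by (simp add: n field_simps)
      finally show "2 * (\<Sum>j=1..i. l j / total i * real j) \<le> real n" .
    qed
    finally show ?thesis .
  qed
qed

text \<open>
  The exponent 3 leaves \<open>\<Sum>n. 1 / n ^ 2\<close> after taking expectations, so the weighted sum of all
  \<open>2 ^ gen n\<close> is a.s. finite and bounds each of its terms.
\<close>

lemma AE_gen_le:
  "AE \<omega> in M. \<exists>C. \<forall>n\<ge>1. 2 ^ gen \<omega> n \<le> C * real n ^ 3"
proof -
  let ?f = "\<lambda>n \<omega>. 2 ^ gen \<omega> (Suc n) * ennreal (1 / real (Suc n) ^ 3)"
  have meas: "?f n \<in> borel_measurable M" for n
    by (rule measurable_gen)
  have sq: "summable (\<lambda>n. 1 / real (Suc n) ^ 2)"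
    using inverse_power_summable[of 2, where 'a = real] by (subst summable_Suc_iff) (simp add: inverse_eq_divide)
  have "(\<integral>\<^sup>+\<omega>. (\<Sum>n. ?f n \<omega>) \<partial>M) = (\<Sum>n. \<integral>\<^sup>+\<omega>. ?f n \<omega> \<partial>M)"
    by (rule nn_integral_suminf[OF meas])
  also have "\<dots> \<le> (\<Sum>n. ennreal (1 / real (Suc n) ^ 2))"
  proof (intro suminf_le summableI)
    fix n
    have "(\<integral>\<^sup>+\<omega>. ?f n \<omega> \<partial>M) = (\<integral>\<^sup>+\<omega>. 2 ^ gen \<omega> (Suc n) \<partial>M) * ennreal (1 / real (Suc n) ^ 3)"
      by (intro nn_integral_multc measurable_gen)
    also have "\<dots> \<le> ennreal (real (Suc n)) * ennreal (1 / real (Suc n) ^ 3)"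
      by (intro mult_right_mono nn_integral_gen_le) auto
    also have "\<dots> = ennreal (1 / real (Suc n) ^ 2)"
      by (simp add: power2_eq_square power3_eq_cube del: of_nat_Suc flip: ennreal_mult)
    finally show "(\<integral>\<^sup>+\<omega>. ?f n \<omega> \<partial>M) \<le> ennreal (1 / real (Suc n) ^ 2)" .
  qed
  also have "\<dots> = ennreal (\<Sum>n. 1 / real (Suc n) ^ 2)"
    using sq by (intro suminf_ennreal2) auto
  finally have "(\<integral>\<^sup>+\<omega>. (\<Sum>n. ?f n \<omega>) \<partial>M) \<noteq> \<infinity>"
    by (auto simp: top_unique)
  then have "AE \<omega> in M. (\<Sum>n. ?f n \<omega>) \<noteq> \<infinity>"
    using meas by (intro nn_integral_noteq_infinite borel_measurable_suminf) auto
  then show ?thesis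
  proof eventually_elim
    case (elim \<omega>)
    define C where "C = enn2real (\<Sum>n. ?f n \<omega>)"
    have C: "(\<Sum>n. ?f n \<omega>) = ennreal C" "0 \<le> C"
      using elim by (auto simp: C_def less_top)
    have "2 ^ gen \<omega> n \<le> C * real n ^ 3" if n1: "n \<ge> 1" for n
    proof -
      obtain m where n: "n = Suc m" using n1 by (cases n) auto
      have "(\<Sum>k\<in>{m}. ?f k \<omega>) \<le> (\<Sum>k. ?f k \<omega>)"
        by (intro sum_le_suminf summableI) auto
      then have "?f m \<omega> \<le> ennreal C" unfolding C by simp
      then have "ennreal (2 ^ gen \<omega> n * (1 / real n ^ 3)) \<le> ennreal C"
        by (subst ennreal_mult) (simp_all add: n del: of_nat_Suc flip: ennreal_power)
      then show ?thesis
        using C(2) n1 by (simp add: ennreal_le_iff divide_le_eq)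
    qed
    then show ?case by blast
  qed
qed

text \<open>
  Taking logarithms in \<open>AE_gen_le\<close>, a stick of generation \<open>i\<close> has index at least
  \<open>2 ^ (i div 3 - c)\<close> and is no longer than the stick with that index.
\<close>

lemma AE_height_finite:
  assumes "summable (\<lambda>n. l (2 ^ n))"
  shows "AE \<omega> in M. rooted_height (stick_limit l (\<lambda>i. X i \<omega>)) < \<infinity>"
  using AE_gen_le AE_stick_positions
proof eventually_elim
  case (elim \<omega>)
  then obtain C where C: "\<And>n. n \<ge> 1 \<Longrightarrow> 2 ^ gen \<omega> n \<le> C * real n ^ 3" by blast
  interpret stick_positions l "\<lambda>i. X i \<omega>" by fact
  obtain c where c: "C \<le> 2 ^ c"
    using real_arch_pow[of 2 C] less_imp_le by auto
  define b where "b i = l (2 ^ (i div 3 - c))" for i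
  show ?case
  proof (rule rooted_height_finite[of b])
    fix k :: nat assume k: "1 \<le> k"
    let ?g = "gen \<omega> k"
    have "(2 ^ (?g div 3)) ^ 3 \<le> (2 ^ ?g :: real)"
      unfolding power_mult[symmetric] by (intro power_increasing) auto
    also have "\<dots> \<le> 2 ^ c * real k ^ 3"
      using C[OF k] mult_right_mono[OF c, of "real k ^ 3"] by simp
    also have "\<dots> \<le> (2 ^ c) ^ 3 * real k ^ 3"
      by (intro mult_right_mono self_le_power) auto
    also have "\<dots> = (2 ^ c * real k) ^ 3"
      by (simp add: power_mult_distrib)
    finally have "2 ^ (?g div 3) \<le> 2 ^ c * real k"
      by (subst (asm) power_mono_iff) auto
    then have "real (2 ^ (?g div 3)) \<le> real (2 ^ c * k)" by simp
    then have le: "2 ^ (?g div 3) \<le> 2 ^ c * k" by (simp only: of_nat_le_iff)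
    have "2 ^ (?g div 3 - c) \<le> k"
    proof (cases "c \<le> ?g div 3")
      case True
      then have "2 ^ (?g div 3) = 2 ^ c * (2 ^ (?g div 3 - c) :: nat)"
        by (simp flip: power_add)
      then show ?thesis using le by simp
    qed (use k in simp)
    then show "l k \<le> b ?g"
      unfolding b_def by (intro l_mono) auto
  next
    show "0 \<le> b i" for i
      using l_pos[of "2 ^ (i div 3 - c)"] by (simp add: b_def less_imp_le)
  next
    \<comment> \<open>Up to a shift, every term \<open>l (2 ^ n)\<close> occurs three times in the series of \<open>b\<close>.\<close>
    have thrice: "(\<Sum>i<3 * N. l (2 ^ (i div 3))) = 3 * (\<Sum>i<N. l (2 ^ i))" for N
    proof (induction N)
      case (Suc N)
      have "3 * Suc N = Suc (Suc (Suc (3 * N)))" by simp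
      moreover have "Suc (3 * N) div 3 = N" "Suc (Suc (3 * N)) div 3 = N" by presburger+
      ultimately show ?case using Suc by (simp only: sum.lessThan_Suc) simp
    qed simp
    have nonneg: "0 \<le> l (2 ^ i)" for i :: nat
      using l_pos[of "2 ^ i"] by (simp add: less_imp_le)
    have "summable (\<lambda>i. l (2 ^ (i div 3)))"
    proof (rule summableI_nonneg_bounded)
      fix N
      have "(\<Sum>i<N. l (2 ^ (i div 3))) \<le> (\<Sum>i<3 * N. l (2 ^ (i div 3)))"
        using nonneg by (intro sum_mono2) auto
      also have "\<dots> \<le> 3 * (\<Sum>i. l (2 ^ i))"
        unfolding thrice using sum_le_suminf[OF assms, of "{..<N}"] nonneg by simp
      finally show "(\<Sum>i<N. l (2 ^ (i div 3))) \<le> 3 * (\<Sum>i. l (2 ^ i))" .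
    qed (rule nonneg)
    then have "summable (\<lambda>i. b (i + 3 * c))"
      by (simp add: b_def)
    then show "summable b" by (simp only: summable_iff_shift)
  qed
qed

section \<open>A path through all blocks\<close>

lemma mono_block_time: "mono block_time"
  using block_time_less by (intro incseq_SucI) (auto simp: less_imp_le)

lemma measurable_climbers:
  assumes "\<And>Z. f Z \<in> space N"
  shows "(\<lambda>\<omega>. f (climbers block_time (code \<omega>) r)) \<in> measurable M N"
proof (rule measurable_finitely_determined[of "{block_time 1..<block_time (Suc r)}"])
  fix x y :: "nat \<Rightarrow> nat \<times> bool"
  assume "\<And>i. i \<in> {block_time 1..<block_time (Suc r)} \<Longrightarrow> x i = y i"
  with mono_block_time have "climbers block_time x r = climbers block_time y r"
    by (rule climbers_cong)
  then show "f (climbers block_time x r) = f (climbers block_time y r)" by simp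
qed (use assms block_time_ge_1[of 1] in auto)

lemma prob_attach_outer_half_ge:
  assumes i: "i \<ge> 1" and s: "s \<subseteq> {1..i}" and c: "0 \<le> c" "\<And>j. j \<in> s \<Longrightarrow> c \<le> l j"
  shows "real (card s) * (c / (2 * total i))
    \<le> prob {\<omega> \<in> space M. fst (code \<omega> i) \<in> s \<and> snd (code \<omega> i)}"
proof -
  let ?E = "\<lambda>j. {\<omega> \<in> space M. X i \<omega> \<in> {j} \<times> {l j / 2<..l j}}"
  have fin: "finite s" using s finite_subset by blast
  have "real (card s) * (c / (2 * total i)) = (\<Sum>j\<in>s. c / (2 * total i))" by simp
  also have "\<dots> \<le> (\<Sum>j\<in>s. (l j - l j / 2) / total i)"
    using c(2) total_pos[OF i] by (intro sum_mono) (simp add: field_simps)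
  also have "\<dots> = (\<Sum>j\<in>s. prob (?E j))"
  proof (intro sum.cong refl)
    fix j assume "j \<in> s"
    then have "1 \<le> j" "j \<le> i" using s by auto
    then show "(l j - l j / 2) / total i = prob (?E j)"
      using prob_segment[OF i, of j "l j / 2"] l_pos[of j] by simp
  qed
  also have "\<dots> = prob (\<Union>j\<in>s. ?E j)"
    using segment_event[OF i] fin
    by (intro finite_measure_finite_Union[symmetric]) (auto simp: disjoint_family_on_def)
  also have "\<dots> \<le> prob {\<omega> \<in> space M. fst (code \<omega> i) \<in> s \<and> snd (code \<omega> i)}"
  proof (rule finite_measure_mono)
    have "Measurable.pred M (\<lambda>\<omega>. fst (code \<omega> i) \<in> s \<and> snd (code \<omega> i))"
      using i by (intro measurable_finitely_determined[of "{i}"]) auto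
    then show "{\<omega> \<in> space M. fst (code \<omega> i) \<in> s \<and> snd (code \<omega> i)} \<in> sets M"
      by (simp add: pred_def)
  qed (auto simp: code_def stick_code_def)
  finally show ?thesis .
qed

text \<open>
  The factor that attachment \<open>i\<close> contributes to the conditional mean of \<open>(1 / 2) ^ Z\<close>, with \<open>s\<close> the
  current set of climbers: \<open>1 - p / 2 \<le> exp (- p / 2)\<close> for a success probability \<open>p\<close>.
\<close>

lemma nn_integral_attach_le:
  assumes i: "i \<ge> 1" and s: "s \<subseteq> {1..i}" and c: "0 \<le> c" "\<And>j. j \<in> s \<Longrightarrow> c \<le> l j"
  shows "(\<integral>\<^sup>+\<omega>. (if fst (code \<omega> i) \<in> s \<and> snd (code \<omega> i) then inverse 2 else 1) \<partial>M)
    \<le> ennreal (exp (- real (card s) * (c / (4 * total i))))"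
proof -
  let ?E = "{\<omega> \<in> space M. fst (code \<omega> i) \<in> s \<and> snd (code \<omega> i)}"
  have "Measurable.pred M (\<lambda>\<omega>. fst (code \<omega> i) \<in> s \<and> snd (code \<omega> i))"
    using i by (intro measurable_finitely_determined[of "{i}"]) auto
  then have E: "?E \<in> sets M" by (simp add: pred_def)
  then have int_E: "integrable M (\<lambda>\<omega>. indicator ?E \<omega> / 2 :: real)"
    by (intro integrable_divide integrable_real_indicator) (auto simp: emeasure_eq_measure)
  then have int: "integrable M (\<lambda>\<omega>. 1 - indicator ?E \<omega> / 2 :: real)"
    by (intro Bochner_Integration.integrable_diff) auto
  have "(\<integral>\<^sup>+\<omega>. (if fst (code \<omega> i) \<in> s \<and> snd (code \<omega> i) then inverse 2 else 1) \<partial>M)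
      = (\<integral>\<^sup>+\<omega>. ennreal (1 - indicator ?E \<omega> / 2) \<partial>M)"
    by (intro nn_integral_cong) (auto simp: indicator_def)
  also have "\<dots> = ennreal (\<integral>\<omega>. 1 - indicator ?E \<omega> / 2 \<partial>M)"
    using int by (intro nn_integral_eq_integral) (auto simp: indicator_def)
  also have "(\<integral>\<omega>. 1 - indicator ?E \<omega> / 2 \<partial>M) = 1 - prob ?E / 2"
    using int_E by (subst Bochner_Integration.integral_diff)
      (auto simp: prob_space sets.Int_space_eq2[OF E])
  also have "\<dots> \<le> exp (- (prob ?E / 2))"
    using exp_ge_add_one_self[of "- (prob ?E / 2)"] by simp
  also have "\<dots> \<le> exp (- real (card s) * (c / (4 * total i)))"
    using prob_attach_outer_half_ge[OF assms] by (simp add: mult.commute[of c])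
  finally show ?thesis by (simp add: ennreal_leI)
qed

text \<open>
  Given the climbers \<open>s\<close> of block \<open>r\<close>, the attachments of the next block are independent, and by the
  choice of the block the product of their factors is at most \<open>exp (- card s) \<le> (1 / 2) ^ card s\<close>.
\<close>

lemma nn_integral_half_power_climbers_Suc:
  "(\<integral>\<^sup>+\<omega>. inverse 2 ^ card (climbers block_time (code \<omega>) (Suc r)) \<partial>M)
    \<le> (\<integral>\<^sup>+\<omega>. inverse 2 ^ card (climbers block_time (code \<omega>) r) \<partial>M)"
proof -
  let ?a = "block_time (Suc r)" and ?b = "block_time (Suc (Suc r))"
  let ?Z = "\<lambda>y. climbers block_time y r"
  define F :: "(nat \<Rightarrow> nat \<times> bool) \<Rightarrow> (nat \<Rightarrow> nat \<times> bool) \<Rightarrow> ennreal" where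
    "F = (\<lambda>x y. \<Prod>i\<in>{?a..<?b}. if fst (y i) \<in> ?Z x \<and> snd (y i) then inverse 2 else 1)"
  have pow: "inverse 2 ^ card (climbers block_time y (Suc r)) = F y y" for y
    by (simp add: F_def card_image prod.If_cases Int_def)
  have "(\<integral>\<^sup>+\<omega>. F (code \<omega>) (code \<omega>) \<partial>M) = (\<integral>\<^sup>+\<omega>. (\<integral>\<^sup>+\<omega>'. F (code \<omega>) (code \<omega>') \<partial>M) \<partial>M)"
  proof (rule nn_integral_independent_codes[of "{block_time 1..<?a}" "{?a..<?b}"])
    fix x x' y y' :: "nat \<Rightarrow> nat \<times> bool"
    assume x: "\<And>i. i \<in> {block_time 1..<?a} \<Longrightarrow> x i = x' i"
      and y: "\<And>i. i \<in> {?a..<?b} \<Longrightarrow> y i = y' i"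
    from mono_block_time x have "?Z x = ?Z x'" by (rule climbers_cong)
    then show "F x y = F x' y'" unfolding F_def using y by (intro prod.cong) auto
  qed (use block_time_ge_1[of 1] block_time_ge_1[of "Suc r"] in auto)
  also have "\<dots> \<le> (\<integral>\<^sup>+\<omega>. inverse 2 ^ card (?Z (code \<omega>)) \<partial>M)"
  proof (rule nn_integral_mono)
    fix \<omega>
    define s where "s = ?Z (code \<omega>)"
    have s: "s \<subseteq> {block_time r<..?a}" unfolding s_def by (rule climbers_subset)
    have l: "l ?a \<le> l j" if "j \<in> s" for j
      using s that block_time_ge_1[of r] by (intro l_mono) auto
    have la: "0 < l ?a" using l_pos block_time_ge_1 by blast
    have "(\<integral>\<^sup>+\<omega>'. F (code \<omega>) (code \<omega>') \<partial>M)
        = (\<Prod>i\<in>{?a..<?b}. \<integral>\<^sup>+\<omega>'. (if fst (code \<omega>' i) \<in> s \<and> snd (code \<omega>' i) then inverse 2 else 1) \<partial>M)"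
      unfolding F_def s_def[symmetric]
    proof (rule indep_vars_nn_integral)
      have "indep_vars (\<lambda>_. count_space UNIV) (\<lambda>i \<omega>. code \<omega> i) {?a..<?b}"
        using block_time_ge_1[of "Suc r"] by (intro indep_vars_subset[OF indep_code]) auto
      then show "indep_vars (\<lambda>_. borel)
          (\<lambda>i \<omega>'. if fst (code \<omega>' i) \<in> s \<and> snd (code \<omega>' i) then inverse 2 else 1 :: ennreal) {?a..<?b}"
        by (rule indep_vars_compose2[where Y = "\<lambda>_ p. if fst p \<in> s \<and> snd p then inverse 2 else 1"]) simp
    qed auto
    also have "\<dots> \<le> (\<Prod>i\<in>{?a..<?b}. ennreal (exp (- real (card s) * (l ?a / (4 * total i)))))"
      using s l la block_time_ge_1[of "Suc r"] block_time_ge_1[of r]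
      by (intro prod_mono_ennreal nn_integral_attach_le) (auto simp: less_imp_le)
    also have "\<dots> = ennreal (exp (\<Sum>i\<in>{?a..<?b}. - real (card s) * (l ?a / (4 * total i))))"
      by (simp add: prod_ennreal exp_sum)
    also have "(\<Sum>i\<in>{?a..<?b}. - real (card s) * (l ?a / (4 * total i))) = - real (card s) * (exposure ?a ?b / 4)"
      by (simp add: exposure_def sum_distrib_left sum_divide_distrib sum_negf mult.commute[of 4])
    also have "\<dots> \<le> - real (card s)"
    proof -
      have "4 \<le> exposure ?a ?b"
        using exposure_next_time[OF block_time_ge_1] by (simp add: block_time_Suc[of "Suc r"])
      then have "real (card s) * 1 \<le> real (card s) * (exposure ?a ?b / 4)"
        by (intro mult_left_mono) auto
      then show ?thesis by simp
    qed
    also have "exp (- real (card s)) = exp (- 1) ^ card s"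
      by (simp add: exp_of_nat_mult[symmetric])
    also have "\<dots> \<le> (1 / 2) ^ card s"
    proof (rule power_mono)
      show "exp (- 1) \<le> (1 / 2 :: real)"
        using exp_ge_add_one_self[of 1] by (simp add: exp_minus field_simps)
    qed simp
    finally show "(\<integral>\<^sup>+\<omega>'. F (code \<omega>) (code \<omega>') \<partial>M) \<le> inverse 2 ^ card (?Z (code \<omega>))"
      by (simp add: s_def ennreal_leI flip: ennreal_power)
  qed
  finally show ?thesis unfolding pow .
qed

text \<open>
  Extinction costs the supermartingale the value 1, while it starts from at most \<open>1 / 2\<close> because every
  stick of the nonempty block 0 counts as a climber.
\<close>

lemma prob_climbers_nonempty:
  "prob {\<omega> \<in> space M. climbers block_time (code \<omega>) r \<noteq> {}} \<ge> 1 / 2"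
proof -
  let ?Z = "\<lambda>\<omega>. climbers block_time (code \<omega>) r"
  let ?E = "{\<omega> \<in> space M. ?Z \<omega> = {}}"
  have "Measurable.pred M (\<lambda>\<omega>. ?Z \<omega> = {})"
    by (rule measurable_climbers) simp
  then have E [measurable]: "?E \<in> sets M" by (simp add: pred_def)
  have "emeasure M ?E = (\<integral>\<^sup>+\<omega>. indicator ?E \<omega> \<partial>M)" by simp
  also have "\<dots> \<le> (\<integral>\<^sup>+\<omega>. inverse 2 ^ card (?Z \<omega>) \<partial>M)"
    by (intro nn_integral_mono) (auto simp: indicator_def)
  also have "\<dots> \<le> (\<integral>\<^sup>+\<omega>. inverse 2 ^ card (climbers block_time (code \<omega>) 0) \<partial>M)"
  proof (induction r)
    case (Suc r)
    show ?case by (rule order_trans[OF nn_integral_half_power_climbers_Suc Suc.IH])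
  qed simp
  also have "\<dots> = inverse 2 ^ (block_time 1 - block_time 0)"
    by (simp add: emeasure_space_1)
  also have "\<dots> \<le> (inverse 2 :: ennreal) ^ 1"
  proof (rule power_decreasing)
    show "1 \<le> block_time 1 - block_time 0"
      using block_time_less[of 0] by simp
    have "ennreal (1 / 2) \<le> ennreal 1" by (rule ennreal_leI) simp
    then show "inverse 2 \<le> (1 :: ennreal)" by simp
  qed simp
  also have "\<dots> = ennreal (1 / 2)"
    by simp
  finally have "ennreal (prob ?E) \<le> ennreal (1 / 2)"
    by (simp only: emeasure_eq_measure)
  then have "prob ?E \<le> 1 / 2"
    by (subst (asm) ennreal_le_iff) auto
  moreover have "{\<omega> \<in> space M. ?Z \<omega> \<noteq> {}} = space M - ?E" by auto
  ultimately show ?thesis by (simp add: prob_compl)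
qed

text \<open>
  The bound \<open>1 / 2\<close> does not depend on the block and the events decrease, so with positive
  probability no block is missed; a single outcome of this kind with finite height bounds all
  partial sums of \<open>l\<close> along the block times.
\<close>

lemma summable_if_AE_height_finite:
  assumes fin: "AE \<omega> in M. rooted_height (stick_limit l (\<lambda>i. X i \<omega>)) < \<infinity>"
  shows "summable (\<lambda>n. l n / real n)"
proof -
  define E where "E r = {\<omega> \<in> space M. climbers block_time (code \<omega>) r \<noteq> {}}" for r
  have E: "E r \<in> sets M" for r
  proof -
    have "Measurable.pred M (\<lambda>\<omega>. climbers block_time (code \<omega>) r \<noteq> {})"
      by (rule measurable_climbers) simp
    then show ?thesis by (simp add: pred_def E_def)
  qed
  have "decseq E"
    using climbers_empty_Suc unfolding E_def by (intro decseq_SucI) blast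
  then have "(\<lambda>r. prob (E r)) \<longlonglongrightarrow> prob (\<Inter>r. E r)"
    using E by (intro finite_Lim_measure_decseq) auto
  then have "1 / 2 \<le> prob (\<Inter>r. E r)"
    using prob_climbers_nonempty by (intro LIMSEQ_le_const) (auto simp: E_def)
  then have "\<not> (AE \<omega> in M. \<omega> \<notin> (\<Inter>r. E r))"
    using E by (subst prob_eq_0[symmetric]) auto
  then have "\<exists>\<omega>\<in>\<Inter>r. E r. rooted_height (stick_limit l (\<lambda>i. X i \<omega>)) < \<infinity> \<and> stick_positions l (\<lambda>i. X i \<omega>)"
  proof (rule contrapos_np)
    assume none: "\<not> ?thesis"
    show "AE \<omega> in M. \<omega> \<notin> (\<Inter>r. E r)"
      using fin AE_stick_positions by eventually_elim (use none in blast)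
  qed
  then obtain \<omega> where \<omega>: "\<And>r. climbers block_time (code \<omega>) r \<noteq> {}"
      "rooted_height (stick_limit l (\<lambda>i. X i \<omega>)) < \<infinity>" "stick_positions l (\<lambda>i. X i \<omega>)"
    unfolding E_def by blast
  interpret stick_positions l "\<lambda>i. X i \<omega>" by fact
  obtain H where H: "rooted_height (stick_limit l (\<lambda>i. X i \<omega>)) = ennreal H" "0 \<le> H"
    using \<omega>(2) by (auto simp: less_top_ennreal)
  have "summable (\<lambda>r. l (block_time (Suc r)))"
  proof (rule summableI_nonneg_bounded)
    fix R
    have "ennreal ((\<Sum>r<R. l (block_time (Suc r))) / 2) \<le> ennreal H"
      unfolding H(1)[symmetric]
    proof (rule rooted_height_ge_of_climbers[OF block_time_ge_1])
      show "l (block_time (Suc r)) \<le> l j" if "j \<in> {block_time r<..block_time (Suc r)}" for r j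
        using that block_time_ge_1[of r] by (intro l_mono) auto
      show "climbers block_time (\<lambda>i. stick_code l (X i \<omega>)) R \<noteq> {}"
        using \<omega>(1)[of R] by (simp add: code_def[abs_def])
    qed
    then show "(\<Sum>r<R. l (block_time (Suc r))) \<le> 2 * H"
      using H(2) by simp
  next
    show "0 \<le> l (block_time (Suc r))" for r
      using l_pos[OF block_time_ge_1] by (simp add: less_imp_le)
  qed
  then have "summable (\<lambda>r. l (block_time r))"
    by (subst (asm) summable_Suc_iff)
  then show ?thesis by (rule summable_if_summable_block_time)
qed

end

section \<open>The criterion\<close>

theorem theorem1p11:
  fixes M :: "'w measure" and l :: "nat \<Rightarrow> real" and X :: "nat \<Rightarrow> 'w \<Rightarrow> nat \<times> real"
  assumes pos: "\<And>i. i \<ge> 1 \<Longrightarrow> l i > 0"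
    and decreasing: "antimono_on {1..} l"
    and sticks: "stick_breaking M l X"
  shows "((AE \<omega> in M. rooted_height (stick_limit l (\<lambda>i. X i \<omega>)) < \<infinity>)
           \<longleftrightarrow> (\<lambda>n. l n / real n) summable_on {1..})
       \<and> ((AE \<omega> in M. rooted_height (stick_limit l (\<lambda>i. X i \<omega>)) < \<infinity>)
           \<longleftrightarrow> (\<lambda>n. l (2 ^ n)) summable_on {1..})"
proof -
  interpret decreasing_lengths l
    using pos decreasing by unfold_locales (auto simp: monotone_on_def)
  interpret stick_breaking M l X by fact
  interpret decreasing_stick_breaking M l X ..
  have on: "f summable_on {1..} \<longleftrightarrow> summable f" if "\<And>n. 1 \<le> n \<Longrightarrow> 0 \<le> f n" for f :: "nat \<Rightarrow> real"
  proof -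
    have "f summable_on {1..} \<longleftrightarrow> (\<lambda>n. f (Suc n)) summable_on UNIV"
      using summable_on_reindex[of Suc UNIV f] by (simp add: o_def atLeast_Suc_greaterThan flip: greaterThan_0)
    also have "\<dots> \<longleftrightarrow> summable (\<lambda>n. f (Suc n))"
      using that by (intro summable_on_UNIV_nonneg_real_iff) simp
    finally show ?thesis by (simp only: summable_Suc_iff)
  qed
  show ?thesis
    using on[of "\<lambda>n. l n / real n"] on[of "\<lambda>n. l (2 ^ n)"] AE_height_finite summable_if_AE_height_finite
      summable_iff_condensed l_pos by (auto simp: less_imp_le)
qed

end
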